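(* $\mathsf{MLR}\equiv_{\mathrm W}(\mathsf C_{\mathbb N}\rightarrow\mathsf{PC}_{\{0,1\}^{\mathbb N}})\equiv_{\mathrm W}(\mathsf C_{\mathbb N}\rightarrow\mathsf{WWKL})$.
   Context: A represented space $\mathbf X=(X,\delta_X)$ is a set $X$ with a partial surjection $\delta_X:\subseteq\mathbb N^{\mathbb N}\to X$ (the symbol $\subseteq$ marks possibly partial functions). A multi-valued function $f:\subseteq\mathbf X\rightrightarrows\mathbf Y$ assigns to each $x\in\mathrm{dom}(f)\subseteq X$ a nonempty set $f(x)\subseteq Y$. Composition: $z\in(f\circ g)(x)$ iff $g(x)\subseteq\mathrm{dom}(f)$ and $z\in f(y)$ for some $y\in g(x)$ (with $x\in\mathrm{dom}(g)$). $F:\subseteq\mathbb N^{\mathbb N}\to\mathbb N^{\mathbb N}$ is a realizer of $f$, $F\vdash f$, if $\delta_YF(p)\in f\delta_X(p)$ for all $p\in\mathrm{dom}(f\delta_X)$. $f\leq_{\mathrm W}g$ iff there are computable $K,H:\subseteq\mathbb N^{\mathbb N}\to\mathbb N^{\mathbb N}$ with $K\langle\mathrm{id},GH\rangle\vdash f$ for all $G\vdash g$; $\equiv_{\mathrm W}$ is the induced equivalence. Space $\mathcal M(\mathbf X,\mathbf Y)$: fix a universal Turing machine; $\Phi_p:\subseteq\mathbb N^{\mathbb N}\to\mathbb N^{\mathbb N}$ is the partial function it computes with first input $p$, i.e. $\Phi_p(q)=r$ iff on input $\langle p,q\rangle$ it produces the infinite output $r$. Let $\delta_X^{\mathrm{cyl}}\langle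 p,q\rangle:=\delta_X(p)$, $\Phi_p^{\mathbf X,\mathbf Y}:=\delta_Y\circ\Phi_p\circ(\delta_X^{\mathrm{cyl}})^{-1}$. $\mathcal M(\mathbf X,\mathbf Y)$ is the represented space of all $\Phi_p^{\mathbf X,\mathbf Y}$, with $p$ as a name. Implication: for $f:\subseteq\mathbf U\rightrightarrows\mathbf V$ and $g:\subseteq\mathbf X\rightrightarrows\mathbf Y$ with $\mathrm{dom}(g)\neq\emptyset$, $(g\rightarrow f):\subseteq\mathbf U\rightrightarrows\mathcal M(\mathbf Y,\mathbf V)\times\mathbf X$ has domain $\mathrm{dom}(f)$ and $(H,x)\in(g\rightarrow f)(u)$ iff $(H\circ g)(x)\subseteq f(u)$ (where $x\in\mathrm{dom}(H\circ g)$). $\mathcal A(\mathbf X)$ is the space of closed subsets of $\mathbf X$ represented by negative information: for $\mathbb N$ a name of $A$ is an enumeration of $\mathbb N\setminus A$; for $\{0,1\}^{\mathbb N}$ it is an enumeration of finite words $w$ such that the complement of $A$ is the union of the cylinders $w\{0,1\}^{\mathbb N}$. Closed choice $\mathsf C_{\mathbf X}:\subseteq\mathcal A(\mathbf X)\rightrightarrows\mathbf X$, $A\mapsto A$, is defined for all nonempty $A$. $\mathsf{PC}_{\{0,1\}^{\mathbb N}}$ is the restriction of $\mathsf C_{\{0,1\}^{\mathbb N}}$ to closed sets of positive uniform measure $\mu$. $\mathsf{WWKL}:\subseteq\mathrm{Tr}\rightrightarrows\{0,1\}^{\mathbb N}$, $T\mapsto[T]$, maps every infinite binary tree $T$ (given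 by its characteristic function) with $\mu([T])>0$ to the set $[T]$ of its infinite paths. $\mathsf{MLR}:\{0,1\}^{\mathbb N}\rightrightarrows\{0,1\}^{\mathbb N}$ is defined by $q\in\mathsf{MLR}(p)$ iff $q$ is Martin-Löf random relative to $p$. *)

theory Defs
  imports "HOL-Probability.Probability" "HOL-Library.Nat_Bijection"
begin

section \<open>Computability on Baire space\<close>

type_synonym baire = "nat \<Rightarrow> nat"

text \<open>
  Machines that read an infinite input \<open>s\<close> are rendered as programs for the partial recursive
  functions on \<open>nat\<close> (in the unary presentation, with tuples coded by \<^const>\<open>prod_encode\<close>) that
  may in addition query \<open>s\<close>.  A program outputs the infinite sequence \<open>r\<close> on input \<open>s\<close> if for
  every \<open>n\<close> it computes \<open>r n\<close> from \<open>n\<close>.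
\<close>

datatype prog =
    Zero
  | Succ
  | Fst
  | Snd
  | Query
  | Tup prog prog
  | Comp prog prog
  | PrimRec prog prog
  | Mu prog

definition minimize :: "(nat \<Rightarrow> nat option) \<Rightarrow> nat option" where
  "minimize f =
     (if \<exists>n. f n = Some 0 \<and> (\<forall>m<n. f m \<noteq> None) then Some (LEAST n. f n = Some 0) else None)"

primrec eval :: "baire \<Rightarrow> prog \<Rightarrow> nat \<Rightarrow> nat option" where
  "eval s Zero x = Some 0"
| "eval s Succ x = Some (Suc x)"
| "eval s Fst x = Some (fst (prod_decode x))"
| "eval s Snd x = Some (snd (prod_decode x))"
| "eval s Query x = Some (s x)"
| "eval s (Tup c d) x =
     Option.bind (eval s c x) (\<lambda>y. Option.bind (eval s d x) (\<lambda>z. Some (prod_encode (y, z))))"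
| "eval s (Comp c d) x = Option.bind (eval s d x) (eval s c)"
| "eval s (PrimRec c d) x =
     (case prod_decode x of (a, n) \<Rightarrow>
        rec_nat (eval s c a)
          (\<lambda>m r. Option.bind r (\<lambda>y. eval s d (prod_encode (a, prod_encode (m, y))))) n)"
| "eval s (Mu c) x = minimize (\<lambda>n. eval s c (prod_encode (x, n)))"

definition compute :: "prog \<Rightarrow> baire \<rightharpoonup> baire" where
  "compute c s =
     (if \<forall>n. eval s c n \<noteq> None then Some (\<lambda>n. the (eval s c n)) else None)"

text \<open>As usual, the machine may produce output also outside the domain of the function.\<close>

definition computable :: "(baire \<rightharpoonup> baire) \<Rightarrow> bool" where
  "computable F \<longleftrightarrow> (\<exists>c. F \<subseteq>\<^sub>m compute c)"

definition bpair :: "baire \<Rightarrow> baire \<Rightarrow> baire" where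
  "bpair p q = (\<lambda>n. if even n then p (n div 2) else q (n div 2))"

definition bfst :: "baire \<Rightarrow> baire" where
  "bfst s = (\<lambda>n. s (2 * n))"

definition bsnd :: "baire \<Rightarrow> baire" where
  "bsnd s = (\<lambda>n. s (2 * n + 1))"

primrec prog_code :: "prog \<Rightarrow> nat" where
  "prog_code Zero = prod_encode (0, 0)"
| "prog_code Succ = prod_encode (1, 0)"
| "prog_code Fst = prod_encode (2, 0)"
| "prog_code Snd = prod_encode (3, 0)"
| "prog_code Query = prod_encode (4, 0)"
| "prog_code (Tup c d) = prod_encode (5, prod_encode (prog_code c, prog_code d))"
| "prog_code (Comp c d) = prod_encode (6, prod_encode (prog_code c, prog_code d))"
| "prog_code (PrimRec c d) = prod_encode (7, prod_encode (prog_code c, prog_code d))"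
| "prog_code (Mu c) = prod_encode (8, prog_code c)"

lemma inj_prog_code: "inj prog_code"
proof (rule injI)
  show "c = d" if "prog_code c = prog_code d" for c d
    using that by (induction c arbitrary: d) (case_tac d; auto)+
qed

text \<open>
  The universal machine runs, on input \<open>s\<close>, the program whose code is \<open>s 0\<close>.  Since
  \<open>bpair p q 0 = p 0\<close>, the sequence \<open>p\<close> in \<open>Phi p q\<close> provides a program in its first place and
  an arbitrary infinite parameter in the remaining ones.
\<close>

definition universal :: "baire \<rightharpoonup> baire" where
  "universal s =
     (if s 0 \<in> range prog_code then compute (inv prog_code (s 0)) s else None)"

definition Phi :: "baire \<Rightarrow> baire \<rightharpoonup> baire" where
  "Phi p q = universal (bpair p q)"


section \<open>Represented spaces and multi-valued functions\<close>

text \<open>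
  A represented space is given by its representation, the underlying set being its range.
  A multi-valued function has the empty value exactly outside its domain.
\<close>

type_synonym 'a rep = "baire \<rightharpoonup> 'a"

type_synonym ('a, 'b) mvf = "'a \<Rightarrow> 'b set"

definition mdom :: "('a, 'b) mvf \<Rightarrow> 'a set" where
  "mdom f = {x. f x \<noteq> {}}"

definition mcomp :: "('b, 'c) mvf \<Rightarrow> ('a, 'b) mvf \<Rightarrow> ('a, 'c) mvf" where
  "mcomp f g = (\<lambda>x. {z. x \<in> mdom g \<and> g x \<subseteq> mdom f \<and> (\<exists>y\<in>g x. z \<in> f y)})"

definition mv_of :: "('a \<rightharpoonup> 'b) \<Rightarrow> ('a, 'b) mvf" where
  "mv_of f = (\<lambda>x. set_option (f x))"

definition mv_inverse :: "('a \<rightharpoonup> 'b) \<Rightarrow> ('b, 'a) mvf" where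
  "mv_inverse f = (\<lambda>y. {x. f x = Some y})"

definition prod_rep :: "'a rep \<Rightarrow> 'b rep \<Rightarrow> ('a \<times> 'b) rep" where
  "prod_rep \<delta> \<epsilon> s =
     Option.bind (\<delta> (bfst s)) (\<lambda>x. Option.bind (\<epsilon> (bsnd s)) (\<lambda>y. Some (x, y)))"

definition cyl_rep :: "'a rep \<Rightarrow> 'a rep" where
  "cyl_rep \<delta> s = \<delta> (bfst s)"

definition Phi_mv :: "'a rep \<Rightarrow> 'b rep \<Rightarrow> baire \<Rightarrow> ('a, 'b) mvf" where
  "Phi_mv \<delta> \<epsilon> p = mcomp (mv_of \<epsilon>) (mcomp (mv_of (Phi p)) (mv_inverse (cyl_rep \<delta>)))"

definition mvf_rep :: "'a rep \<Rightarrow> 'b rep \<Rightarrow> ('a, 'b) mvf rep" where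
  "mvf_rep \<delta> \<epsilon> p = Some (Phi_mv \<delta> \<epsilon> p)"


section \<open>Weihrauch reducibility and implication\<close>

text \<open>A multi-valued function together with its source and target space.\<close>

record ('a, 'b) problem =
  src :: "'a rep"
  tgt :: "'b rep"
  fn :: "('a, 'b) mvf"

definition realizes :: "(baire \<rightharpoonup> baire) \<Rightarrow> ('a, 'b) problem \<Rightarrow> bool" where
  "realizes F f \<longleftrightarrow>
     (\<forall>p x. src f p = Some x \<and> x \<in> mdom (fn f) \<longrightarrow>
        (\<exists>r y. F p = Some r \<and> tgt f r = Some y \<and> y \<in> fn f x))"

definition weihrauch_le :: "('a, 'b) problem \<Rightarrow> ('c, 'd) problem \<Rightarrow> bool" (infix "\<le>\<^sub>W" 50) where
  "f \<le>\<^sub>W g \<longleftrightarrow>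
     (\<exists>K H. computable K \<and> computable H \<and>
        (\<forall>G. realizes G g \<longrightarrow>
           realizes (\<lambda>p. Option.bind (Option.bind (H p) G) (\<lambda>r. K (bpair p r))) f))"

definition weihrauch_equiv :: "('a, 'b) problem \<Rightarrow> ('c, 'd) problem \<Rightarrow> bool" (infix "\<equiv>\<^sub>W" 50) where
  "f \<equiv>\<^sub>W g \<longleftrightarrow> f \<le>\<^sub>W g \<and> g \<le>\<^sub>W f"

definition implication ::
    "('x, 'y) problem \<Rightarrow> ('u, 'v) problem \<Rightarrow> ('u, ('y, 'v) mvf \<times> 'x) problem"
    (infixr "\<rightarrow>\<^sub>W" 55) where
  "g \<rightarrow>\<^sub>W f =
     \<lparr>src = src f,
      tgt = prod_rep (mvf_rep (tgt g) (tgt f)) (src g),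
      fn = (\<lambda>u. {(H, x). u \<in> mdom (fn f) \<and> H \<in> ran (mvf_rep (tgt g) (tgt f)) \<and>
                   x \<in> mdom (mcomp H (fn g)) \<and> mcomp H (fn g) x \<subseteq> fn f u})\<rparr>"


section \<open>Natural numbers, Cantor space, trees\<close>

type_synonym cantor = "nat \<Rightarrow> bool"

definition nat_rep :: "nat rep" where
  "nat_rep p = Some (p 0)"

definition cantor_rep :: "cantor rep" where
  "cantor_rep p = (if range p \<subseteq> {0, 1} then Some (\<lambda>n. p n = 1) else None)"

text \<open>The uniform measure.\<close>

definition \<mu> :: "cantor measure" where
  "\<mu> = Pi\<^sub>M UNIV (\<lambda>_. uniform_count_measure UNIV)"

definition cylinder :: "bool list \<Rightarrow> cantor set" where
  "cylinder w = {x. \<forall>i<length w. x i = w ! i}"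

text \<open>Bijective base-2 numeration, a bijection between words and natural numbers.\<close>

primrec word_code :: "bool list \<Rightarrow> nat" where
  "word_code [] = 0"
| "word_code (b # w) = 2 * word_code w + (if b then 2 else 1)"

text \<open>
  Closed sets by negative information.  An entry \<open>Suc k\<close> of a name enumerates \<open>k\<close>, while the entry
  \<open>0\<close> enumerates nothing, so that the empty set can be enumerated as well.
\<close>

definition closed_nat_rep :: "nat set rep" where
  "closed_nat_rep p = Some (- {n. Suc n \<in> range p})"

definition closed_cantor_rep :: "cantor set rep" where
  "closed_cantor_rep p = Some (- (\<Union>w\<in>{w. Suc (word_code w) \<in> range p}. cylinder w))"

definition is_tree :: "bool list set \<Rightarrow> bool" where
  "is_tree T \<longleftrightarrow> (\<forall>v w. v @ w \<in> T \<longrightarrow> v \<in> T)"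

definition paths :: "bool list set \<Rightarrow> cantor set" where
  "paths T = {x. \<forall>n. map x [0..<n] \<in> T}"

definition tree_rep :: "bool list set rep" where
  "tree_rep p =
     (let T = {w. p (word_code w) = 1}
      in if range p \<subseteq> {0, 1} \<and> is_tree T then Some T else None)"


section \<open>The problems\<close>

definition closed_choice :: "('a::topological_space set, 'a) mvf" where
  "closed_choice A = (if closed A then A else {})"

definition C_nat :: "(nat set, nat) problem" where
  "C_nat = \<lparr>src = closed_nat_rep, tgt = nat_rep, fn = closed_choice\<rparr>"

definition C_cantor :: "(cantor set, cantor) problem" where
  "C_cantor = \<lparr>src = closed_cantor_rep, tgt = cantor_rep, fn = closed_choice\<rparr>"

definition PC_cantor :: "(cantor set, cantor) problem" where
  "PC_cantor = C_cantor\<lparr>fn := (\<lambda>A. if measure \<mu> A > 0 then fn C_cantor A else {})\<rparr>"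

definition WWKL :: "(bool list set, cantor) problem" where
  "WWKL =
     \<lparr>src = tree_rep, tgt = cantor_rep,
      fn = (\<lambda>T. if is_tree T \<and> infinite T \<and> measure \<mu> (paths T) > 0 then paths T else {})\<rparr>"

text \<open>
  A Martin-Loef test relative to \<open>p\<close> is a sequence of open sets \<open>U n\<close> with \<open>\<mu> (U n) \<le> 2 ^ (- n)\<close>
  that is uniformly c.e. in \<open>p\<close>, that is, generated by a set of pairs \<open>(n, w)\<close> which is the domain
  of a partial function computable from \<open>p\<close>.
\<close>

definition uniformly_ce_open :: "cantor \<Rightarrow> (nat \<Rightarrow> cantor set) \<Rightarrow> bool" where
  "uniformly_ce_open p U \<longleftrightarrow>
     (\<exists>c. \<forall>n. U n =
        (\<Union>w\<in>{w. eval (\<lambda>i. of_bool (p i)) c (prod_encode (n, word_code w)) \<noteq> None}. cylinder w))"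

definition ml_test :: "cantor \<Rightarrow> (nat \<Rightarrow> cantor set) \<Rightarrow> bool" where
  "ml_test p U \<longleftrightarrow> uniformly_ce_open p U \<and> (\<forall>n. measure \<mu> (U n) \<le> (1 / 2) ^ n)"

definition ml_random :: "cantor \<Rightarrow> cantor \<Rightarrow> bool" where
  "ml_random p q \<longleftrightarrow> (\<forall>U. ml_test p U \<longrightarrow> q \<notin> (\<Inter>n. U n))"

definition MLR :: "(cantor, cantor) problem" where
  "MLR = \<lparr>src = cantor_rep, tgt = cantor_rep, fn = (\<lambda>p. {q. ml_random p q})\<rparr>"

end

theory Submission
  imports Defs
begin

text \<open>
  The three problems are reduced to each other in a cycle.

  A Martin-Loef random sequence yields \<open>PC\<close> up to \<open>C_nat\<close>: if \<open>A\<close> is a closed set of positive measure and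
  \<open>q\<close> is random relative to a name of \<open>A\<close>, then some tail of \<open>q\<close> lies in \<open>A\<close> (Kucera), since
  otherwise \<open>q\<close> splits into blocks from a prefix-free set that generates the complement of \<open>A\<close>, and
  having \<open>n\<close> such blocks has probability \<open>(1 - \<mu> A) ^ n\<close>. The set of \<open>n\<close> such that dropping \<open>n\<close> bits
  of \<open>q\<close> leads into \<open>A\<close> is closed with a computable name, and \<open>n \<mapsto> drop_seq n q\<close> is the required function.

  Conversely, the complement of a universal test is a set of paths of positive measure that contains only
  random sequences. Running the given function on a convergent sequence of guesses for an element of
  the given subset of the natural numbers yields a sequence that differs from such a path at finitely
  many places only, and hence is random.
\<close>

section \<open>Total computable functionals\<close>

text \<open>The cycle runs from \<open>MLR\<close> to trees, from trees to closed sets and back to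
  \<open>MLR\<close>; passing from closed sets to trees then goes through randomness.

  Two obstacles call for a step-indexed interpreter inside the machine model. \<open>eval\<close> is
  a denotation without running times, while a universal test has to decide what each test has
  enumerated after \<open>t\<close> steps. Moreover, the function that comes with an answer set is
  only guaranteed to be defined on that set: a run on a wrong guess may diverge, so it cannot be
  awaited, and runs of bounded length are tried stage by stage.

  A run on a wrong guess may also halt with a wrong bit. Bit \<open>i\<close> is therefore computed
  only at stages from \<open>i\<close> on, so that only finitely many bits are wrong once the
  guesses have settled. Being a path of a given tree would not survive such errors; being random
  does.\<close>

abbreviation pr :: "nat \<Rightarrow> nat \<Rightarrow> nat" where "pr a b \<equiv> prod_encode (a, b)"
abbreviation p1 :: "nat \<Rightarrow> nat" where "p1 z \<equiv> fst (prod_decode z)"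
abbreviation p2 :: "nat \<Rightarrow> nat" where "p2 z \<equiv> snd (prod_decode z)"

text \<open>
  Total functionals computed by one program uniformly in the oracle. The closure rules are stated
  for arbitrary lambda terms, so that \<open>intro\<close> decomposes a functional along its syntax.
\<close>

definition recf :: "(baire \<Rightarrow> nat \<Rightarrow> nat) \<Rightarrow> bool" where
  "recf f \<longleftrightarrow> (\<exists>c. \<forall>s x. eval s c x = Some (f s x))"

named_theorems recf_intros

lemma recf_id [recf_intros]: "recf (\<lambda>s x. x)"
proof -
  \<comment> \<open>Splitting a number and pairing it again gives it back, since the pairing is a
    bijection.\<close>
  have "\<forall>s x. eval s (Comp Fst (Tup (Tup Fst Snd) Zero)) x = Some x" by simp
  then show ?thesis unfolding recf_def by blast
qed

lemma recf_query: "recf (\<lambda>s x. s x)"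
  unfolding recf_def by (rule exI[of _ Query]) simp

lemma recf_comp:
  assumes "recf g" "recf f" shows "recf (\<lambda>s x. g s (f s x))"
proof -
  from assms obtain c d where "\<forall>s x. eval s c x = Some (g s x)" "\<forall>s x. eval s d x = Some (f s x)"
    unfolding recf_def by blast
  then have "\<forall>s x. eval s (Comp c d) x = Some (g s (f s x))" by simp
  then show ?thesis unfolding recf_def by blast
qed

lemma recf_oracle [recf_intros]: "recf f \<Longrightarrow> recf (\<lambda>s x. s (f s x))"
  by (rule recf_comp[OF recf_query])

lemma recf_Suc [recf_intros]: "recf f \<Longrightarrow> recf (\<lambda>s x. Suc (f s x))"
  by (rule recf_comp[where g="\<lambda>s x. Suc x"]) (auto simp: recf_def intro: exI[of _ Succ])

lemma recf_fst [recf_intros]: "recf f \<Longrightarrow> recf (\<lambda>s x. p1 (f s x))"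
  by (rule recf_comp[where g="\<lambda>s x. p1 x"]) (auto simp: recf_def intro: exI[of _ Fst])

lemma recf_snd [recf_intros]: "recf f \<Longrightarrow> recf (\<lambda>s x. p2 (f s x))"
  by (rule recf_comp[where g="\<lambda>s x. p2 x"]) (auto simp: recf_def intro: exI[of _ Snd])

lemma recf_pair [recf_intros]:
  assumes "recf f" "recf g" shows "recf (\<lambda>s x. pr (f s x) (g s x))"
proof -
  from assms obtain c d where "\<forall>s x. eval s c x = Some (f s x)" "\<forall>s x. eval s d x = Some (g s x)"
    unfolding recf_def by blast
  then have "\<forall>s x. eval s (Tup c d) x = Some (pr (f s x) (g s x))" by simp
  then show ?thesis unfolding recf_def by blast
qed

lemma recf_const [recf_intros]: "recf (\<lambda>s x. k)"
proof (induction k)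
  case 0
  show ?case unfolding recf_def by (rule exI[of _ Zero]) simp
next
  case (Suc k)
  then show ?case by (rule recf_Suc)
qed

text \<open>Programs take one number, so a functional of two arguments is treated in uncurried form
  on pairs; this rule returns to curried arguments.\<close>

lemma recf_comp2:
  assumes "recf (\<lambda>s z. h s (p1 z) (p2 z))" "recf f" "recf g"
  shows "recf (\<lambda>s x. h s (f s x) (g s x))"
  using recf_comp[OF assms(1) recf_pair[OF assms(2,3)]] by simp

lemma recf_comp3:
  assumes "recf (\<lambda>s z. h s (p1 z) (p1 (p2 z)) (p2 (p2 z)))" "recf f" "recf g" "recf k"
  shows "recf (\<lambda>s x. h s (f s x) (g s x) (k s x))"
  using recf_comp[OF assms(1) recf_pair[OF assms(2) recf_pair[OF assms(3,4)]]] by simp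

lemma recf_rec_nat [recf_intros]:
  assumes "recf g" and "recf n" and "recf (\<lambda>s z. h s (p1 z) (p1 (p2 z)) (p2 (p2 z)))"
  shows "recf (\<lambda>s x. rec_nat (g s x) (h s x) (n s x))"
proof -
  from assms obtain c d where c: "\<forall>s x. eval s c x = Some (g s x)"
    and d: "\<forall>s x. eval s d x = Some (h s (p1 x) (p1 (p2 x)) (p2 (p2 x)))"
    unfolding recf_def by blast
  have "rec_nat (eval s c a) (\<lambda>m r. Option.bind r (\<lambda>y. eval s d (pr a (pr m y)))) k
      = Some (rec_nat (g s a) (h s a) k)" for s a k
    by (induction k) (simp_all add: c d)
  then have "recf (\<lambda>s z. rec_nat (g s (p1 z)) (h s (p1 z)) (p2 z))"
    unfolding recf_def by (intro exI[of _ "PrimRec c d"]) (simp split: prod.split)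
  from recf_comp2[where h="\<lambda>s a k. rec_nat (g s a) (h s a) k", OF this recf_id assms(2)]
  show ?thesis .
qed

lemma recf_add [recf_intros]:
  assumes "recf f" "recf g" shows "recf (\<lambda>s x. f s x + g s x)"
proof -
  have "a + b = rec_nat a (\<lambda>_. Suc) b" for a b :: nat by (induction b) auto
  then show ?thesis using assms by (simp only:) (intro recf_intros)
qed

lemma recf_mult [recf_intros]:
  assumes "recf f" "recf g" shows "recf (\<lambda>s x. f s x * g s x)"
proof -
  have "a * b = rec_nat 0 (\<lambda>_ y. y + a) b" for a b :: nat by (induction b) auto
  moreover have "recf (\<lambda>s x. rec_nat 0 (\<lambda>_ y. y + f s x) (g s x))"
    by (intro recf_intros assms recf_comp[OF assms(1)])
  ultimately show ?thesis by simp
qed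

lemma recf_power [recf_intros]:
  assumes "recf f" "recf g" shows "recf (\<lambda>s x. f s x ^ g s x)"
proof -
  have "a ^ b = rec_nat 1 (\<lambda>_ y. y * a) b" for a b :: nat by (induction b) auto
  moreover have "recf (\<lambda>s x. rec_nat 1 (\<lambda>_ y. y * f s x) (g s x))"
    by (intro recf_intros assms recf_comp[OF assms(1)])
  ultimately show ?thesis by simp
qed

lemma recf_diff [recf_intros]:
  assumes "recf f" "recf g" shows "recf (\<lambda>s x. f s x - g s x)"
proof -
  have pred: "a - 1 = rec_nat 0 (\<lambda>m _. m) a" for a :: nat by (cases a) auto
  have *: "recf (\<lambda>s x. k s x - 1)" if "recf k" for k
    unfolding pred by (intro recf_intros that)
  have "a - b = rec_nat a (\<lambda>_ y. y - 1) b" for a b :: nat by (induction b) auto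
  then have eq: "(\<lambda>s x. f s x - g s x) = (\<lambda>s x. rec_nat (f s x) (\<lambda>_ y. y - 1) (g s x))" by blast
  show ?thesis by (subst eq) (intro recf_intros assms *)
qed

text \<open>Decidable predicates are represented by their characteristic functionals
  \<open>of_bool\<close>, so case distinctions, connectives and bounded quantifiers become
  arithmetic.\<close>

lemma recf_if [recf_intros]:
  assumes "recf (\<lambda>s x. of_bool (P s x))" "recf f" "recf g"
  shows "recf (\<lambda>s x. if P s x then f s x else g s x)"
proof -
  have "(if P s x then f s x else g s x) = of_bool (P s x) * f s x + (1 - of_bool (P s x)) * g s x"
    for s x by simp
  then show ?thesis using assms by (simp only:) (intro recf_intros)
qed

lemma recf_not [recf_intros]:
  assumes "recf (\<lambda>s x. of_bool (P s x))" shows "recf (\<lambda>s x. of_bool (\<not> P s x))"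
proof -
  have "of_bool (\<not> P s x) = 1 - (of_bool (P s x) :: nat)" for s x by simp
  then show ?thesis using assms by (simp only:) (intro recf_intros)
qed

lemma recf_conj [recf_intros]:
  assumes "recf (\<lambda>s x. of_bool (P s x))" "recf (\<lambda>s x. of_bool (Q s x))"
  shows "recf (\<lambda>s x. of_bool (P s x \<and> Q s x))"
proof -
  have "of_bool (P s x \<and> Q s x) = of_bool (P s x) * (of_bool (Q s x) :: nat)" for s x by simp
  then show ?thesis using assms by (simp only:) (intro recf_intros)
qed

lemma recf_le [recf_intros]:
  assumes "recf f" "recf g" shows "recf (\<lambda>s x. of_bool (f s x \<le> g s x))"
proof -
  have "of_bool (f s x \<le> g s x) = 1 - (f s x - g s x)" for s x by simp
  then show ?thesis using assms by (simp only:) (intro recf_intros)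
qed

lemma recf_eq [recf_intros]:
  assumes "recf f" "recf g" shows "recf (\<lambda>s x. of_bool (f s x = g s x))"
  unfolding eq_iff using assms by (intro recf_intros)

lemma recf_less [recf_intros]:
  assumes "recf f" "recf g" shows "recf (\<lambda>s x. of_bool (f s x < g s x))"
  unfolding less_eq_Suc_le using assms by (intro recf_intros)

lemma recf_sum [recf_intros]:
  assumes "recf n" "recf (\<lambda>s z. h s (p1 z) (p2 z))"
  shows "recf (\<lambda>s x. \<Sum>i<n s x. h s x i)"
proof -
  have "(\<Sum>i<k. h s x i) = rec_nat 0 (\<lambda>m y. y + h s x m) k" for s x k by (induction k) auto
  moreover have "recf (\<lambda>s x. rec_nat 0 (\<lambda>m y. y + h s x m) (n s x))"
    by (intro recf_intros assms(1) recf_comp2[of h, OF assms(2)])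
  ultimately show ?thesis by simp
qed

lemma recf_all_less [recf_intros]:
  assumes "recf n" "recf (\<lambda>s z. of_bool (P s (p1 z) (p2 z)))"
  shows "recf (\<lambda>s x. of_bool (\<forall>i<n s x. P s x i))"
proof -
  have "of_bool (\<forall>i<n s x. P s x i) = (of_bool ((\<Sum>i<n s x. of_bool (\<not> P s x i)) = (0::nat)) :: nat)" for s x
    by auto
  then show ?thesis using assms by (simp only:) (intro recf_intros)
qed

lemma recf_ex_less [recf_intros]:
  assumes "recf n" "recf (\<lambda>s z. of_bool (P s (p1 z) (p2 z)))"
  shows "recf (\<lambda>s x. of_bool (\<exists>i<n s x. P s x i))"
proof -
  have "recf (\<lambda>s x. of_bool (\<not> (\<forall>i<n s x. \<not> P s x i)))"
    by (intro recf_intros assms)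
  then show ?thesis by simp
qed

lemma recf_imp [recf_intros]:
  assumes "recf (\<lambda>s x. of_bool (P s x))" "recf (\<lambda>s x. of_bool (Q s x))"
  shows "recf (\<lambda>s x. of_bool (P s x \<longrightarrow> Q s x))"
proof -
  have "recf (\<lambda>s x. of_bool (\<not> (P s x \<and> \<not> Q s x)))"
    by (intro recf_intros assms)
  then show ?thesis by (simp only: de_Morgan_conj not_not imp_conv_disj)
qed

text \<open>An index contributes 1 as long as no number up to it satisfies \<open>P\<close>, so the
  ones count the numbers below the minimum. This makes bounded search a total functional.\<close>

lemma sum_Least:
  assumes "P l" "l \<le> n"
  shows "(\<Sum>i<n. of_bool (\<forall>j<Suc i. \<not> P j)) = (LEAST i. P i :: nat)"
proof -
  let ?l = "LEAST i. P i"
  have "?l \<le> n" using assms Least_le[of P l] by linarith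
  have "(\<Sum>i<n. of_bool (\<forall>j<Suc i. \<not> P j)) = (\<Sum>i<n. of_bool (i < ?l) :: nat)"
  proof (intro sum.cong refl arg_cong[of _ _ of_bool])
    fix i
    show "(\<forall>j<Suc i. \<not> P j) \<longleftrightarrow> i < ?l"
      using LeastI[of P, OF assms(1)] not_less_Least[of _ P] by (meson less_Suc_eq_le less_le_trans not_le)
  qed
  also have "\<dots> = card ({..<n} \<inter> {i. i < ?l})"
    by (simp add: of_bool_def sum.If_cases)
  also have "{..<n} \<inter> {i. i < ?l} = {..<?l}" using \<open>?l \<le> n\<close> by auto
  finally show ?thesis by simp
qed

lemma recf_even [recf_intros]:
  assumes "recf f" shows "recf (\<lambda>s x. of_bool (even (f s x)))"
proof -
  have "of_bool (even n) = rec_nat (1::nat) (\<lambda>_ y. 1 - y) n" for n :: nat by (induction n) auto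
  then show ?thesis using assms by (simp only:) (intro recf_intros)
qed

lemma recf_div2 [recf_intros]:
  assumes "recf f" shows "recf (\<lambda>s x. f s x div 2)"
proof -
  have "n div 2 = (\<Sum>i<n. 1 - of_bool (even i))" for n :: nat
  proof (induction n)
    case (Suc n) then show ?case by (cases "even n") auto
  qed auto
  then show ?thesis using assms by (simp only:) (intro recf_intros)
qed

text \<open>The search runs on a test that ignores the search variable: it stops at once or
  never.\<close>

lemma recf_semidecidable:
  assumes "recf (\<lambda>s x. of_bool (P s x))"
  obtains c where "\<And>s x. eval s c x \<noteq> None \<longleftrightarrow> P s x"
proof -
  have "recf (\<lambda>s x. of_bool (\<not> P s (p1 x)))"
    using recf_comp[OF assms recf_fst[OF recf_id]] by (rule recf_not)
  then obtain c where "\<forall>s x. eval s c x = Some (of_bool (\<not> P s (p1 x)))" unfolding recf_def by blast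
  then have "eval s (Mu c) x \<noteq> None \<longleftrightarrow> P s x" for s x by (simp add: minimize_def)
  then show ?thesis using that by blast
qed

text \<open>\<open>minimize\<close> requires values at all earlier candidates; the program that is
  searched is total, so a witness is enough.\<close>

lemma recf_minimize:
  assumes "recf (\<lambda>s x. of_bool (P s (p1 x) (p2 x)))"
  obtains c where "\<And>s x n. P s x n \<Longrightarrow> eval s c x = Some (LEAST n. P s x n)"
proof -
  obtain c where c: "\<forall>s x. eval s c x = Some (of_bool (\<not> P s (p1 x) (p2 x)))"
    using recf_not[OF assms] unfolding recf_def by blast
  have "eval s (Mu c) x = Some (LEAST n. P s x n)" if "P s x n" for s x n
    using that by (auto simp: c minimize_def)
  then show ?thesis using that by blast
qed

section \<open>Computing with codes of binary words\<close>

lemma inj_word_code: "inj word_code"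
proof (rule injI)
  show "v = w" if "word_code v = word_code w" for v w
    using that
  proof (induction v arbitrary: w)
    case Nil then show ?case by (cases w) (auto split: if_splits)
  next
    case (Cons a v)
    then obtain b w' where w: "w = b # w'" by (cases w) (auto split: if_splits)
    have "(if a then 2 else 1 :: nat) mod 2 = (if b then 2 else 1) mod 2"
      using arg_cong[OF Cons.prems, of "\<lambda>n. n mod 2"] w by (simp add: mod_simps del: mod_mult_self2 mod_mult_self1)
    then have "a = b" by (auto split: if_splits)
    then show ?case using Cons w by auto
  qed
qed

lemma word_code_eq_iff [simp]: "word_code v = word_code w \<longleftrightarrow> v = w"
  using inj_word_code by (auto dest: injD)

lemma surj_word_code: "surj word_code"
proof -
  have "\<exists>w. word_code w = n" for n
  proof (induction n rule: less_induct)
    case (less n)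
    show ?case
    proof (cases n)
      case 0 then show ?thesis by (intro exI[of _ "[]"]) simp
    next
      case (Suc m)
      obtain w where w: "word_code w = m div 2" using less[of "m div 2"] Suc le_imp_less_Suc[OF div_le_dividend[of m 2]] by blast
      show ?thesis using w Suc by (intro exI[of _ "odd m # w"]) (auto elim!: oddE evenE)
    qed
  qed
  then show ?thesis by (metis surj_def)
qed

definition word_of :: "nat \<Rightarrow> bool list" where "word_of = inv word_code"

lemma word_code_word_of [simp]: "word_code (word_of n) = n"
  unfolding word_of_def by (simp add: surj_word_code surj_f_inv_f)

lemma word_of_word_code [simp]: "word_of (word_code w) = w"
  unfolding word_of_def by (simp add: inj_word_code)

lemma length_le_word_code: "length w \<le> word_code w"
  by (induction w) auto

lemma word_code_less: "word_code w < 2 ^ Suc (length w)"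
proof -
  have "word_code w + 2 \<le> 2 ^ Suc (length w)" by (induction w) auto
  then show ?thesis by linarith
qed

lemma word_code_sum: "word_code w = (\<Sum>i<length w. 2 ^ i * (1 + of_bool (w ! i)))"
  by (induction w) (auto simp: sum.lessThan_Suc_shift sum_distrib_left mult.assoc simp del: sum.lessThan_Suc)

text \<open>The first letter is the least significant digit, 1 or 2, so \<open>(y - 1) div 2\<close>
  removes it. At \<open>0\<close>, the code of the empty word, truncated subtraction gives
  \<open>0\<close> again, as dropping beyond the end requires.\<close>

lemma word_code_drop: "word_code (drop n w) = rec_nat (word_code w) (\<lambda>_ y. (y - 1) div 2) n"
proof (induction n)
  case (Suc n)
  have "(word_code v - 1) div 2 = word_code (tl v)" for v by (cases v) auto
  with Suc show ?case by (metis drop_Suc old.nat.simps(7) tl_drop)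
qed simp

lemma recf_drop [recf_intros]:
  assumes "recf f" "recf g" shows "recf (\<lambda>s x. word_code (drop (f s x) (word_of (g s x))))"
  unfolding word_code_drop using assms by (simp only: word_code_word_of) (intro recf_intros)

lemma word_code_eq_0_iff [simp]: "word_code w = 0 \<longleftrightarrow> w = []"
  by (cases w) auto

lemma recf_length [recf_intros]:
  assumes "recf g" shows "recf (\<lambda>s x. length (word_of (g s x)))"
proof -
  have "length w = (\<Sum>i<word_code w. of_bool (\<not> word_code (drop i w) = 0))" for w
  proof -
    have "(\<Sum>i<word_code w. of_bool (\<not> word_code (drop i w) = 0)) = card ({..<word_code w} \<inter> {i. i < length w})"
      by (simp add: of_bool_def sum.If_cases not_le)
    also have "{..<word_code w} \<inter> {i. i < length w} = {..<length w}" using length_le_word_code[of w] by auto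
    finally show ?thesis by simp
  qed
  then have "length (word_of n) = (\<Sum>i<n. of_bool (\<not> word_code (drop i (word_of n)) = 0))" for n
    by (metis word_code_word_of)
  then show ?thesis using assms by (simp only:) (intro recf_intros recf_comp[OF assms])
qed

lemma even_word_code: "even (word_code w) \<longleftrightarrow> w = [] \<or> hd w"
  by (cases w) auto

text \<open>The digit of \<open>True\<close> is 2, so parity reads off the first letter of the
  dropped word. The bound on the index excludes the empty word, whose code is even as well.\<close>

lemma recf_nth [recf_intros]:
  assumes "recf f" "recf g"
  shows "recf (\<lambda>s x. of_bool (f s x < length (word_of (g s x)) \<and> word_of (g s x) ! f s x))"
proof -
  have "i < length w \<and> w ! i \<longleftrightarrow> i < length w \<and> even (word_code (drop i w))" for i w
    by (auto simp: even_word_code hd_drop_conv_nth)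
  then show ?thesis using assms by (simp only:) (intro recf_intros)
qed

lemma recf_word_code:
  assumes "recf n" "recf (\<lambda>s z. of_bool (b s (p1 z) (p2 z)))"
  shows "recf (\<lambda>s x. word_code (map (b s x) [0..<n s x]))"
proof -
  have "word_code (map (b s x) [0..<n s x]) = (\<Sum>i<n s x. 2 ^ i * (1 + of_bool (b s x i)))" for s x
    unfolding word_code_sum by simp
  then show ?thesis using assms by (simp only:) (intro recf_intros)
qed

lemma recf_take [recf_intros]:
  assumes "recf f" "recf g" shows "recf (\<lambda>s x. word_code (take (f s x) (word_of (g s x))))"
proof -
  let ?m = "\<lambda>s x. if f s x \<le> length (word_of (g s x)) then f s x else length (word_of (g s x))"
  have "take n w = map (\<lambda>i. i < length w \<and> w ! i) [0..<if n \<le> length w then n else length w]" for n and w :: "bool list"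
    by (rule nth_equalityI) auto
  moreover have "recf (\<lambda>s x. word_code (map (\<lambda>i. i < length (word_of (g s x)) \<and> word_of (g s x) ! i) [0..<?m s x]))"
    by (intro recf_word_code recf_intros assms recf_comp[OF assms(2)])
  ultimately show ?thesis by simp
qed

section \<open>A step-indexed interpreter\<close>

text \<open>Frames are the continuations of an abstract machine: what is still to be done with the
  value of a subprogram. In \<open>FRec d a m r\<close>, \<open>m\<close> is the index of the next
  iteration and \<open>r\<close> the number of iterations left; in \<open>FMu c x n\<close>,
  candidate \<open>n\<close> is being tested.\<close>

datatype frame = FTup prog nat | FTup2 nat | FComp prog | FRec prog nat nat nat | FMu prog nat nat

datatype mstate = Ev prog nat "frame list" | Ret nat "frame list"

text \<open>A halted state \<open>Ret y []\<close> steps to itself, so a result persists at all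
  later step counts.\<close>

fun astep :: "baire \<Rightarrow> mstate \<Rightarrow> mstate" where
  "astep s (Ev Zero x k) = Ret 0 k"
| "astep s (Ev Succ x k) = Ret (Suc x) k"
| "astep s (Ev Fst x k) = Ret (p1 x) k"
| "astep s (Ev Snd x k) = Ret (p2 x) k"
| "astep s (Ev Query x k) = Ret (s x) k"
| "astep s (Ev (Tup c d) x k) = Ev c x (FTup d x # k)"
| "astep s (Ev (Comp c d) x k) = Ev d x (FComp c # k)"
| "astep s (Ev (PrimRec c d) x k) = Ev c (p1 x) (FRec d (p1 x) 0 (p2 x) # k)"
| "astep s (Ev (Mu c) x k) = Ev c (pr x 0) (FMu c x 0 # k)"
| "astep s (Ret y []) = Ret y []"
| "astep s (Ret y (FTup d x # k)) = Ev d x (FTup2 y # k)"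
| "astep s (Ret y (FTup2 z # k)) = Ret (pr z y) k"
| "astep s (Ret y (FComp c # k)) = Ev c y k"
| "astep s (Ret y (FRec d a m r # k)) =
     (if r = 0 then Ret y k else Ev d (pr a (pr m y)) (FRec d a (Suc m) (r - 1) # k))"
| "astep s (Ret y (FMu c x n # k)) =
     (if y = 0 then Ret n k else Ev c (pr x (Suc n)) (FMu c x (Suc n) # k))"

text \<open>
  The denotation of a state is the value that the remaining computation yields. It is invariant
  under steps, so a halting machine returns the value of the program it was started on.
\<close>

fun denf :: "baire \<Rightarrow> frame \<Rightarrow> nat \<Rightarrow> nat option" where
  "denf s (FTup d x) y = Option.bind (eval s d x) (\<lambda>z. Some (pr y z))"
| "denf s (FTup2 z) y = Some (pr z y)"
| "denf s (FComp c) y = eval s c y"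
| "denf s (FRec d a m r) y =
     rec_nat (Some y) (\<lambda>j v. Option.bind v (\<lambda>y. eval s d (pr a (pr (m + j) y)))) r"
| "denf s (FMu c x n) y =
     (if y = 0 then Some n
      else map_option (\<lambda>i. Suc n + i) (minimize (\<lambda>i. eval s c (pr x (Suc n + i)))))"

primrec den_stack :: "baire \<Rightarrow> frame list \<Rightarrow> nat \<Rightarrow> nat option" where
  "den_stack s [] y = Some y"
| "den_stack s (f # k) y = Option.bind (denf s f y) (den_stack s k)"

fun den :: "baire \<Rightarrow> mstate \<Rightarrow> nat option" where
  "den s (Ev c x k) = Option.bind (eval s c x) (den_stack s k)"
| "den s (Ret y k) = den_stack s k y"

text \<open>Unbounded search in the form in which the machine performs it: test the first candidate,
  then search the shifted function. An undefined first value makes both sides undefined.\<close>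

lemma minimize_unfold:
  "minimize f = Option.bind (f 0) (\<lambda>y. if y = 0 then Some 0 else map_option Suc (minimize (\<lambda>i. f (Suc i))))"
proof (cases "f 0")
  case None
  then have "\<not> (f n = Some 0 \<and> (\<forall>m<n. f m \<noteq> None))" for n by (cases n) auto
  then show ?thesis using None by (simp add: minimize_def)
next
  case (Some y)
  show ?thesis
  proof (cases "y = 0")
    case True
    then show ?thesis using Some by (auto simp: minimize_def)
  next
    case False
    have "(\<exists>n. f n = Some 0 \<and> (\<forall>m<n. f m \<noteq> None)) \<longleftrightarrow>
        (\<exists>n. f (Suc n) = Some 0 \<and> (\<forall>m<n. f (Suc m) \<noteq> None))" (is "?L \<longleftrightarrow> ?R")
    proof
      assume ?L
      then obtain n where n: "f n = Some 0" "\<forall>m<n. f m \<noteq> None" by blast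
      then obtain k where "n = Suc k" using Some False by (cases n) auto
      with n show ?R by auto
    next
      assume ?R
      then obtain n where n: "f (Suc n) = Some 0" "\<forall>m<n. f (Suc m) \<noteq> None" by blast
      then have "\<forall>m<Suc n. f m \<noteq> None" using Some by (auto simp: less_Suc_eq_0_disj)
      with n show ?L by blast
    qed
    moreover have "(LEAST n. f n = Some 0) = Suc (LEAST n. f (Suc n) = Some 0)" if ?R
      using that Some False by (auto intro!: Least_Suc)
    ultimately show ?thesis using Some False by (auto simp: minimize_def)
  qed
qed

lemma rec_nat_bind_None: "rec_nat None (\<lambda>j v. Option.bind v (g j)) n = None"
  by (induction n) auto

text \<open>\<open>rec_nat\<close> unfolds at the last iteration, whereas the machine carries an
  accumulator forward and so performs the first iteration first.\<close>

lemma rec_nat_shift: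
  "rec_nat a h (Suc n) = rec_nat (h 0 a) (\<lambda>j. h (Suc j)) n"
  by (induction n) auto

lemma den_astep: "den s (astep s S) = den s S"
proof (cases "(s, S)" rule: astep.cases)
  case (8 s c d x k)
  obtain a n where x: "prod_decode x = (a, n)" by fastforce
  show ?thesis using 8 x
    by (cases "eval s c a") (auto simp: rec_nat_bind_None)
next
  case (9 s c x k)
  have "minimize (\<lambda>i. eval s c (pr x i)) = Option.bind (eval s c (pr x 0))
     (\<lambda>y. if y = 0 then Some 0 else map_option Suc (minimize (\<lambda>i. eval s c (pr x (Suc i)))))"
    by (rule minimize_unfold)
  then show ?thesis using 9 by (auto split: bind_split)
next
  case (14 s y d a m r k)
  then show ?thesis
    by (cases r) (auto simp: rec_nat_shift rec_nat_bind_None split: bind_split simp del: nat.rec(2))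
next
  case (15 s y c x n k)
  show ?thesis
  proof (cases "y = 0")
    case False
    have "minimize (\<lambda>i. eval s c (pr x (Suc n + i))) = Option.bind (eval s c (pr x (Suc n)))
       (\<lambda>y. if y = 0 then Some 0 else map_option Suc (minimize (\<lambda>i. eval s c (pr x (Suc (Suc n + i))))))"
      by (subst minimize_unfold) (simp cong: if_cong)
    then show ?thesis using 15 False
      by (auto simp: option.map_comp o_def bind_map_option split: bind_split)
  qed (use 15 in simp)
qed (auto split: bind_split)

lemma den_run: "den s ((astep s ^^ t) S) = den s S"
  by (induction t) (auto simp: den_astep)

definition reaches :: "baire \<Rightarrow> mstate \<Rightarrow> mstate \<Rightarrow> bool" where
  "reaches s S S' \<longleftrightarrow> (\<exists>t. (astep s ^^ t) S = S')"

lemma reaches_refl: "reaches s S S"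
  unfolding reaches_def by (rule exI[of _ 0]) simp

lemma reaches_trans: "reaches s S S' \<Longrightarrow> reaches s S' S'' \<Longrightarrow> reaches s S S''"
  unfolding reaches_def by (metis funpow_add o_apply)

lemma reaches_step: "reaches s (astep s S) S' \<Longrightarrow> reaches s S S'"
  unfolding reaches_def by (metis funpow_Suc_right o_apply)

text \<open>The invariant \<open>den\<close> shows that results are correct, not that the machine
  halts. Halting is shown by induction on the program; the stack is arbitrary because subprograms
  run below additional frames.\<close>

lemma reaches_eval: "eval s c x = Some y \<Longrightarrow> reaches s (Ev c x k) (Ret y k)"
proof (induction c arbitrary: x y k)
  case (Tup c d)
  then obtain u v where uv: "eval s c x = Some u" "eval s d x = Some v" "y = pr u v"
    by (auto simp: bind_eq_Some_conv)
  have "reaches s (Ev c x (FTup d x # k)) (Ret u (FTup d x # k))" using Tup uv by blast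
  moreover have "reaches s (Ev d x (FTup2 u # k)) (Ret v (FTup2 u # k))" using Tup uv by blast
  moreover have "reaches s (Ret v (FTup2 u # k)) (Ret y k)"
    by (rule reaches_step) (simp add: uv reaches_refl)
  ultimately show ?case by (metis astep.simps(6,11) reaches_step reaches_trans)
next
  case (Comp c d)
  then obtain u where u: "eval s d x = Some u" "eval s c u = Some y"
    by (auto simp: bind_eq_Some_conv)
  have "reaches s (Ev d x (FComp c # k)) (Ret u (FComp c # k))" using Comp u by blast
  moreover have "reaches s (Ev c u k) (Ret y k)" using Comp u by blast
  ultimately show ?case by (metis astep.simps(7,13) reaches_step reaches_trans)
next
  case (PrimRec c d)
  obtain a n where x: "prod_decode x = (a, n)" by fastforce
  \<comment> \<open>Induction on the number of iterations left; index and accumulator change in each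
    round and are therefore arbitrary.\<close>
  have loop: "denf s (FRec d a m r) u = Some y \<Longrightarrow> reaches s (Ret u (FRec d a m r # k)) (Ret y k)" for m r u
  proof (induction r arbitrary: m u)
    case 0
    then show ?case by (intro reaches_step[of _ "Ret _ _"]) (simp add: reaches_refl)
  next
    case (Suc r)
    from Suc.prems obtain v where v: "eval s d (pr a (pr m u)) = Some v"
      by (cases "eval s d (pr a (pr m u))") (auto simp: rec_nat_shift rec_nat_bind_None simp del: nat.rec(2))
    with Suc.prems have "denf s (FRec d a (Suc m) r) v = Some y"
      by (simp add: rec_nat_shift del: nat.rec(2))
    then have "reaches s (Ret v (FRec d a (Suc m) r # k)) (Ret y k)" by (rule Suc.IH)
    moreover have "reaches s (Ev d (pr a (pr m u)) (FRec d a (Suc m) r # k)) (Ret v (FRec d a (Suc m) r # k))"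
      by (rule PrimRec.IH) (rule v)
    ultimately show ?case by (intro reaches_step[of _ "Ret _ _"]) (auto intro: reaches_trans)
  qed
  from PrimRec.prems x obtain u where u: "eval s c a = Some u"
    by (cases "eval s c a") (auto simp: rec_nat_bind_None)
  have "reaches s (Ev c a (FRec d a 0 n # k)) (Ret u (FRec d a 0 n # k))"
    by (rule PrimRec.IH) (rule u)
  moreover have "reaches s (Ret u (FRec d a 0 n # k)) (Ret y k)"
    by (rule loop) (use PrimRec.prems x u in simp)
  ultimately show ?case using x by (intro reaches_step[of _ "Ev _ _ _"]) (auto intro: reaches_trans)
next
  case (Mu c)
  \<comment> \<open>Induction on the distance \<open>i\<close> from the current candidate
    \<open>n\<close> to the first zero.\<close>
  have loop: "(\<forall>j<i. \<exists>z. eval s c (pr x (n + j)) = Some (Suc z)) \<Longrightarrow> eval s c (pr x (n + i)) = Some 0 \<Longrightarrow>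
      reaches s (Ev c (pr x n) (FMu c x n # k)) (Ret (n + i) k)" for n i
  proof (induction i arbitrary: n)
    case 0
    then have "reaches s (Ev c (pr x n) (FMu c x n # k)) (Ret 0 (FMu c x n # k))"
      by (intro Mu.IH) simp
    moreover have "reaches s (Ret 0 (FMu c x n # k)) (Ret n k)"
      by (rule reaches_step) (simp add: reaches_refl)
    ultimately show ?case by (auto intro: reaches_trans)
  next
    case (Suc i)
    from Suc.prems(1) obtain z where "eval s c (pr x n) = Some (Suc z)" by (metis add_0_right zero_less_Suc)
    then have "reaches s (Ev c (pr x n) (FMu c x n # k)) (Ret (Suc z) (FMu c x n # k))" by (rule Mu.IH)
    moreover have "reaches s (Ev c (pr x (Suc n)) (FMu c x (Suc n) # k)) (Ret (Suc n + i) k)"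
      by (rule Suc.IH) (use Suc.prems in auto)
    then have "reaches s (Ret (Suc z) (FMu c x n # k)) (Ret (n + Suc i) k)"
      by (intro reaches_step[of _ "Ret _ _"]) simp
    ultimately show ?case by (rule reaches_trans)
  qed
  from Mu.prems have y: "y = (LEAST n. eval s c (pr x n) = Some 0)"
    and ex: "\<exists>n. eval s c (pr x n) = Some 0 \<and> (\<forall>m<n. eval s c (pr x m) \<noteq> None)"
    by (auto simp: minimize_def split: if_splits)
  from ex obtain n where n: "eval s c (pr x n) = Some 0" "\<forall>m<n. eval s c (pr x m) \<noteq> None" by blast
  have "y \<le> n" unfolding y by (rule Least_le) (rule n)
  have y0: "eval s c (pr x y) = Some 0" unfolding y by (rule LeastI) (rule n)
  have "\<exists>z. eval s c (pr x j) = Some (Suc z)" if "j < y" for j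
    using that n \<open>y \<le> n\<close> not_less_Least[of j "\<lambda>n. eval s c (pr x n) = Some 0"] y
    by (metis not0_implies_Suc not_None_eq order_less_le_trans)
  with loop[of y 0] y0 show ?case by (intro reaches_step[of _ "Ev _ _ _"]) simp
qed (auto intro!: reaches_step[of _ "Ev _ _ _"] reaches_refl)

section \<open>Arithmetization of the machine\<close>

primrec code_frame :: "frame \<Rightarrow> nat" where
  "code_frame (FTup d x) = pr 1 (pr (prog_code d) x)"
| "code_frame (FTup2 y) = pr 2 y"
| "code_frame (FComp c) = pr 3 (prog_code c)"
| "code_frame (FRec d a m r) = pr 4 (pr (prog_code d) (pr a (pr m r)))"
| "code_frame (FMu c x n) = pr 5 (pr (prog_code c) (pr x n))"

primrec code_stack :: "frame list \<Rightarrow> nat" where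
  "code_stack [] = 0"
| "code_stack (f # k) = Suc (pr (code_frame f) (code_stack k))"

definition ev_state :: "nat \<Rightarrow> nat \<Rightarrow> nat \<Rightarrow> nat" where
  "ev_state c x k = pr 0 (pr c (pr x k))"

text \<open>The dummy \<open>0\<close> puts value and stack at the positions that argument and stack
  have in \<open>ev_state\<close>, so both kinds of states are read by the same projections.\<close>

definition ret_state :: "nat \<Rightarrow> nat \<Rightarrow> nat" where
  "ret_state y k = pr 1 (pr 0 (pr y k))"

primrec code_state :: "mstate \<Rightarrow> nat" where
  "code_state (Ev c x k) = ev_state (prog_code c) x (code_stack k)"
| "code_state (Ret y k) = ret_state y (code_stack k)"

definition push :: "nat \<Rightarrow> nat \<Rightarrow> nat \<Rightarrow> nat" where
  "push i u k = Suc (pr (pr i u) k)"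

text \<open>Defined on all numbers: one that codes no program still takes some branch, so that test
  indices can later range over all natural numbers.\<close>

definition ev_step :: "baire \<Rightarrow> nat \<Rightarrow> nat \<Rightarrow> nat \<Rightarrow> nat" where
  "ev_step s c x k =
     (if p1 c = 0 then ret_state 0 k
      else if p1 c = 1 then ret_state (Suc x) k
      else if p1 c = 2 then ret_state (p1 x) k
      else if p1 c = 3 then ret_state (p2 x) k
      else if p1 c = 4 then ret_state (s x) k
      else if p1 c = 5 then ev_state (p1 (p2 c)) x (push 1 (pr (p2 (p2 c)) x) k)
      else if p1 c = 6 then ev_state (p2 (p2 c)) x (push 3 (p1 (p2 c)) k)
      else if p1 c = 7 then
        ev_state (p1 (p2 c)) (p1 x) (push 4 (pr (p2 (p2 c)) (pr (p1 x) (pr 0 (p2 x)))) k)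
      else ev_state (p2 c) (pr x 0) (push 5 (pr (p2 c) (pr x 0)) k))"

definition frame_step :: "nat \<Rightarrow> nat \<Rightarrow> nat \<Rightarrow> nat \<Rightarrow> nat" where
  "frame_step y i u k =
     (if i = 1 then ev_state (p1 u) (p2 u) (push 2 y k)
      else if i = 2 then ret_state (pr u y) k
      else if i = 3 then ev_state u y k
      else if i = 4 then
        (if p2 (p2 (p2 u)) = 0 then ret_state y k
         else ev_state (p1 u) (pr (p1 (p2 u)) (pr (p1 (p2 (p2 u))) y))
           (push 4 (pr (p1 u) (pr (p1 (p2 u)) (pr (Suc (p1 (p2 (p2 u)))) (p2 (p2 (p2 u)) - 1)))) k))
      else
        (if y = 0 then ret_state (p2 (p2 u)) k
         else ev_state (p1 u) (pr (p1 (p2 u)) (Suc (p2 (p2 u))))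
           (push 5 (pr (p1 u) (pr (p1 (p2 u)) (Suc (p2 (p2 u))))) k)))"

definition ret_step :: "nat \<Rightarrow> nat \<Rightarrow> nat" where
  "ret_step y k =
     (if k = 0 then ret_state y k
      else frame_step y (p1 (p1 (k - 1))) (p2 (p1 (k - 1))) (p2 (k - 1)))"

definition cstep :: "baire \<Rightarrow> nat \<Rightarrow> nat" where
  "cstep s z = (if p1 z = 0 then ev_step s (p1 (p2 z)) (p1 (p2 (p2 z))) (p2 (p2 (p2 z)))
                else ret_step (p1 (p2 (p2 z))) (p2 (p2 (p2 z))))"

lemma cstep_code_state: "cstep s (code_state S) = code_state (astep s S)"
  by (cases "(s, S)" rule: astep.cases)
     (simp_all add: cstep_def ev_step_def ret_step_def frame_step_def ev_state_def ret_state_def push_def)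

text \<open>The value \<open>0\<close> stands for no result within \<open>t\<close> steps.\<close>

definition result :: "baire \<Rightarrow> nat \<Rightarrow> nat \<Rightarrow> nat \<Rightarrow> nat" where
  "result s c x t =
     (let z = rec_nat (ev_state c x 0) (\<lambda>_. cstep s) t
      in if p1 z = 1 \<and> p2 (p2 (p2 z)) = 0 then Suc (p1 (p2 (p2 z))) else 0)"

lemma result_code_eq_Suc:
  "result s (prog_code c) x t = Suc y \<longleftrightarrow> (astep s ^^ t) (Ev c x []) = Ret y []"
proof -
  have z: "rec_nat (ev_state (prog_code c) x 0) (\<lambda>_. cstep s) t = code_state ((astep s ^^ t) (Ev c x []))"
    by (induction t) (simp_all add: cstep_code_state)
  have "code_stack k = 0 \<longleftrightarrow> k = []" for k by (cases k) auto
  then show ?thesis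
    unfolding result_def z Let_def
    by (cases "(astep s ^^ t) (Ev c x [])") (auto simp: ev_state_def ret_state_def)
qed

text \<open>Argued on the numbers themselves, since \<open>c\<close> need not code a program: a
  state of halted shape steps to one of halted shape with the same value.\<close>

lemma result_mono:
  assumes "result s c x t = Suc y" "t \<le> t'"
  shows "result s c x t' = Suc y"
  using assms(2)
proof (induction t' rule: dec_induct)
  case (step n)
  then show ?case
    by (auto simp: result_def Let_def cstep_def ret_step_def ret_state_def split: if_splits)
qed (rule assms(1))

lemma result_sound: "result s (prog_code c) x t = Suc y \<Longrightarrow> eval s c x = Some y"
  unfolding result_code_eq_Suc using den_run[of s t "Ev c x []"] by (cases "eval s c x") simp_all

lemma result_complete: "eval s c x = Some y \<Longrightarrow> \<exists>t. result s (prog_code c) x t = Suc y"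
  unfolding result_code_eq_Suc using reaches_eval[of s c x y "[]"] by (simp add: reaches_def)

lemma recf_ev_state [recf_intros]:
  "recf f \<Longrightarrow> recf g \<Longrightarrow> recf h \<Longrightarrow> recf (\<lambda>s x. ev_state (f s x) (g s x) (h s x))"
  unfolding ev_state_def by (intro recf_intros)

lemma recf_ret_state [recf_intros]:
  "recf f \<Longrightarrow> recf g \<Longrightarrow> recf (\<lambda>s x. ret_state (f s x) (g s x))"
  unfolding ret_state_def by (intro recf_intros)

lemma recf_push [recf_intros]:
  "recf f \<Longrightarrow> recf g \<Longrightarrow> recf h \<Longrightarrow> recf (\<lambda>s x. push (f s x) (g s x) (h s x))"
  unfolding push_def by (intro recf_intros)

lemma recf_frame_step: "recf (\<lambda>s z. frame_step (p1 z) (p1 (p2 z)) (p1 (p2 (p2 z))) (p2 (p2 (p2 z))))"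
  unfolding frame_step_def by (intro recf_intros)

lemma recf_ret_step: "recf (\<lambda>s z. ret_step (p1 z) (p2 z))"
proof -
  have *: "recf (\<lambda>s z. frame_step (f s z) (g s z) (h s z) (k s z))"
    if "recf f" "recf g" "recf h" "recf k" for f g h k
    using recf_comp[OF recf_frame_step recf_pair[OF that(1) recf_pair[OF that(2) recf_pair[OF that(3,4)]]]]
    by simp
  show ?thesis unfolding ret_step_def by (intro recf_intros *)
qed

text \<open>The oracle of the simulated run may depend on a parameter. This is needed where every
  stage runs the simulated program on a guess of its own.\<close>

lemma recf_cstep:
  assumes "recf (\<lambda>s z. orc s (p1 z) (p2 z))"
  shows "recf (\<lambda>s z. cstep (orc s (p1 z)) (p2 z))"
proof -
  have "recf (\<lambda>s z. orc s (f s z) (g s z))" if "recf f" "recf g" for f g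
    by (rule recf_comp2[OF assms that])
  note * = this
  have "recf (\<lambda>s z. ev_step (orc s (p1 z)) (p1 (p2 z)) (p1 (p2 (p2 z))) (p2 (p2 (p2 z))))"
    unfolding ev_step_def by (intro recf_intros *)
  then have **: "recf (\<lambda>s z. ev_step (orc s (f s z)) (g s z) (h s z) (k s z))"
    if "recf f" "recf g" "recf h" "recf k" for f g h k
    using recf_comp[OF _ recf_pair[OF that(1) recf_pair[OF that(2) recf_pair[OF that(3,4)]]]]
    by fastforce
  show ?thesis unfolding cstep_def
    by (intro recf_intros ** recf_comp2[OF recf_ret_step])
qed

lemma recf_result:
  assumes "recf (\<lambda>s z. orc s (p1 z) (p2 z))" "recf f" "recf g" "recf h" "recf k"
  shows "recf (\<lambda>s z. result (orc s (f s z)) (g s z) (h s z) (k s z))"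
proof -
  have *: "recf (\<lambda>s x. rec_nat (ev_state (g s x) (h s x) 0) (\<lambda>_. cstep (orc s (f s x))) (k s x))"
    by (intro recf_intros assms recf_comp2[OF recf_cstep[OF assms(1)]] recf_comp[OF assms(2)])
  show ?thesis unfolding result_def Let_def by (intro recf_intros *)
qed

section \<open>The uniform measure\<close>

abbreviation coin :: "bool measure" where "coin \<equiv> uniform_count_measure UNIV"

interpretation coin: prob_space coin
  by (rule prob_space_uniform_count_measure) auto

interpretation coins: sequence_space coin ..

lemma prob_space_mu: "prob_space \<mu>"
  unfolding \<mu>_def by (rule prob_space_PiM) (rule coin.prob_space_axioms)

interpretation mu: prob_space \<mu> by (rule prob_space_mu)

lemma measurable_coin: "measurable M coin = measurable M (count_space UNIV)"
  by (rule measurable_cong_sets) (simp_all add: sets_uniform_count_measure)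

lemma space_mu [simp]: "space \<mu> = UNIV"
  by (simp add: \<mu>_def space_PiM space_uniform_count_measure)

lemma measurable_component_mu [measurable]: "(\<lambda>x. x i) \<in> measurable \<mu> (count_space UNIV)"
  unfolding \<mu>_def measurable_coin[symmetric] by (rule measurable_component_singleton) (rule UNIV_I)

lemma measurable_into_mu:
  assumes "\<And>n. (\<lambda>x. f x n) \<in> measurable M (count_space UNIV)"
  shows "f \<in> measurable M \<mu>"
  unfolding \<mu>_def by (rule measurable_abs_UNIV) (rule assms[folded measurable_coin])

lemma vimage_in_sets_mu:
  assumes "f \<in> measurable \<mu> \<mu>" "R \<in> sets \<mu>" shows "{x. f x \<in> R} \<in> sets \<mu>"
  using measurable_sets[OF assms] by (simp add: vimage_def)

lemma measurable_case_nat_mu: "case_nat c \<in> measurable \<mu> \<mu>"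
proof (rule measurable_into_mu)
  show "(\<lambda>x. case_nat c x n) \<in> measurable \<mu> (count_space UNIV)" for n
    by (cases n) simp_all
qed

text \<open>The uniform measure is the image of coin times uniform measure under prepending a bit.
  Conditioning on the first bit is the only access to the product structure that the following
  inductions need.\<close>

lemma measure_mu_split:
  assumes R: "R \<in> sets \<mu>"
  shows "measure \<mu> R = (measure \<mu> {x. case_nat True x \<in> R} + measure \<mu> {x. case_nat False x \<in> R}) / 2"
proof -
  have eq: "\<mu> = distr (coin \<Otimes>\<^sub>M \<mu>) \<mu> (\<lambda>(s, x). case_nat s x)"
    unfolding \<mu>_def by (rule coins.PiM_iter[symmetric])
  have m: "(\<lambda>(s, x). case_nat s x) \<in> measurable (coin \<Otimes>\<^sub>M \<mu>) \<mu>"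
  proof (rule measurable_into_mu)
    show "(\<lambda>y. (case y of (s, x) \<Rightarrow> case_nat s x) n) \<in> measurable (coin \<Otimes>\<^sub>M \<mu>) (count_space UNIV)" for n
      by (cases n) (simp_all add: split_beta')
  qed
  have half: "emeasure \<mu> A * ennreal (1 / 2) = ennreal (measure \<mu> A / 2)" for A
    unfolding mu.emeasure_eq_measure by (subst ennreal_mult''[symmetric]) simp_all
  have "emeasure \<mu> R = emeasure (distr (coin \<Otimes>\<^sub>M \<mu>) \<mu> (\<lambda>(s, x). case_nat s x)) R"
    using eq by simp
  also have "\<dots> = emeasure (coin \<Otimes>\<^sub>M \<mu>) {(s, x). case_nat s x \<in> R}"
    using R m by (subst emeasure_distr)
      (auto simp: space_pair_measure space_uniform_count_measure intro!: arg_cong[of _ _ "emeasure _"])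
  also have "\<dots> = (\<integral>\<^sup>+ s. emeasure \<mu> {x. case_nat s x \<in> R} \<partial>coin)"
  proof (subst mu.emeasure_pair_measure_alt)
    show "{(s, x). case_nat s x \<in> R} \<in> sets (coin \<Otimes>\<^sub>M \<mu>)"
      using measurable_sets[OF m R]
      by (simp add: vimage_def space_pair_measure space_uniform_count_measure split_beta')
  qed (simp add: vimage_def)
  also have "\<dots> = (\<Sum>s\<in>UNIV. emeasure \<mu> {x. case_nat s x \<in> R} * ennreal (1 / 2))"
    unfolding uniform_count_measure_def
    by (subst nn_integral_point_measure_finite) (simp_all add: mult.commute)
  also have "\<dots> = ennreal ((measure \<mu> {x. case_nat True x \<in> R} + measure \<mu> {x. case_nat False x \<in> R}) / 2)"
    by (simp only: UNIV_bool half) (simp add: add_divide_distrib add.commute flip: ennreal_plus)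
  finally show ?thesis
    by (simp add: mu.emeasure_eq_measure)
qed

lemma sets_cylinder [measurable]: "cylinder w \<in> sets \<mu>"
proof -
  have "cylinder w = {x \<in> space \<mu>. \<forall>i\<in>{..<length w}. x i = w ! i}" by (auto simp: cylinder_def)
  also have "\<dots> \<in> sets \<mu>" by measurable
  finally show ?thesis .
qed

lemma mem_cylinder_iff: "x \<in> cylinder w \<longleftrightarrow> map x [0..<length w] = w"
  unfolding cylinder_def list_eq_iff_nth_eq by simp

lemma case_nat_mem_cylinder_Cons: "case_nat c x \<in> cylinder (b # w) \<longleftrightarrow> c = b \<and> x \<in> cylinder w"
  by (simp add: cylinder_def All_less_Suc2)

definition drop_seq :: "nat \<Rightarrow> cantor \<Rightarrow> cantor" where
  "drop_seq n x = (\<lambda>i. x (n + i))"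

lemma measurable_drop_seq: "drop_seq n \<in> measurable \<mu> \<mu>"
  by (rule measurable_into_mu) (simp add: drop_seq_def)

text \<open>Each letter of \<open>w\<close> kills one of the two halves. This is the independence of
  the tail from the first bits, and \<open>R = UNIV\<close> gives the measure of a cylinder.\<close>

lemma measure_cylinder_drop_seq:
  assumes R: "R \<in> sets \<mu>"
  shows "measure \<mu> {x \<in> cylinder w. drop_seq (length w) x \<in> R} = (1 / 2) ^ length w * measure \<mu> R"
proof (induction w)
  case Nil
  then show ?case by (simp add: cylinder_def drop_seq_def)
next
  case (Cons b w)
  let ?A = "\<lambda>w. {x \<in> cylinder w. drop_seq (length w) x \<in> R}"
  have sets: "?A w \<in> sets \<mu>" for w
    using sets.Int[OF sets_cylinder[of w] vimage_in_sets_mu[OF measurable_drop_seq[of "length w"] R]]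
    by (simp add: Int_def)
  have "drop_seq (Suc n) (case_nat c x) = drop_seq n x" for n c x by (simp add: drop_seq_def)
  then have "{x. case_nat c x \<in> ?A (b # w)} = (if c = b then ?A w else {})" for c
    by (auto simp: case_nat_mem_cylinder_Cons)
  then have "measure \<mu> (?A (b # w)) = measure \<mu> (?A w) / 2"
    by (subst measure_mu_split[OF sets]) (cases b; simp)
  then show ?case using Cons by simp
qed

lemma measure_cylinder: "measure \<mu> (cylinder w) = (1 / 2) ^ length w"
  using measure_cylinder_drop_seq[of UNIV w] sets.top[of \<mu>] mu.prob_space by simp

definition flip :: "nat \<Rightarrow> cantor \<Rightarrow> cantor" where
  "flip k x = x(k := \<not> x k)"

lemma measurable_flip: "flip k \<in> measurable \<mu> \<mu>"
proof (rule measurable_into_mu)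
  show "(\<lambda>x. flip k x n) \<in> measurable \<mu> (count_space UNIV)" for n
    by (cases "n = k") (simp_all add: flip_def)
qed

text \<open>A flip at position \<open>0\<close> exchanges the two summands of
  \<open>measure_mu_split\<close>; any other flip passes to the tail.\<close>

lemma measure_flip: "R \<in> sets \<mu> \<Longrightarrow> measure \<mu> {x. flip k x \<in> R} = measure \<mu> R"
proof (induction k arbitrary: R)
  case 0
  have "flip 0 (case_nat c x) = case_nat (\<not> c) x" for c x
    by (auto simp: flip_def fun_eq_iff split: nat.split)
  then show ?case
    by (subst (1 2) measure_mu_split) (auto intro: vimage_in_sets_mu[OF measurable_flip] 0)
next
  case (Suc k)
  have "flip (Suc k) (case_nat c x) = case_nat c (flip k x)" for c x
    by (auto simp: flip_def fun_eq_iff split: nat.split)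
  moreover have "measure \<mu> {x. case_nat c (flip k x) \<in> R} = measure \<mu> {x. case_nat c x \<in> R}" for c
    using Suc.IH[OF vimage_in_sets_mu[OF measurable_case_nat_mu Suc.prems]] by simp
  ultimately show ?case
    by (subst (1 2) measure_mu_split) (auto intro: vimage_in_sets_mu[OF measurable_flip] Suc.prems)
qed

lemma finite_words: "finite {w :: bool list. length w = n \<and> P w}"
  by (rule finite_subset[OF _ finite_lists_length_eq[of UNIV n]]) auto

lemma Collect_prefix_eq: "{x. P (map x [0..<t])} = (\<Union>w\<in>{w. length w = t \<and> P w}. cylinder w)"
proof (intro set_eqI iffI)
  fix x assume "x \<in> {x. P (map x [0..<t])}"
  then have "map x [0..<t] \<in> {w. length w = t \<and> P w}" "x \<in> cylinder (map x [0..<t])"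
    by (simp_all add: mem_cylinder_iff)
  then show "x \<in> (\<Union>w\<in>{w. length w = t \<and> P w}. cylinder w)" by blast
next
  fix x assume "x \<in> (\<Union>w\<in>{w. length w = t \<and> P w}. cylinder w)"
  then obtain w where "length w = t" "P w" "x \<in> cylinder w" by blast
  then show "x \<in> {x. P (map x [0..<t])}" unfolding mem_cylinder_iff by simp
qed

lemma sets_Collect_prefix: "{x. P (map x [0..<t])} \<in> sets \<mu>"
  unfolding Collect_prefix_eq by (rule sets.finite_UN) (simp_all add: finite_words sets_cylinder)

text \<open>Cylinders of different words of one length are disjoint, so measuring is counting. This
  turns a measure bound into a comparison of natural numbers that a program can decide.\<close>

lemma measure_Collect_prefix:
  "measure \<mu> {x. P (map x [0..<t])} = real (card {w. length w = t \<and> P w}) / 2 ^ t"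
proof -
  have "measure \<mu> {x. P (map x [0..<t])} = (\<Sum>w\<in>{w. length w = t \<and> P w}. measure \<mu> (cylinder w))"
    unfolding Collect_prefix_eq
    by (rule mu.finite_measure_finite_Union)
       (auto simp: finite_words disjoint_family_on_def mem_cylinder_iff)
  also have "\<dots> = (\<Sum>w\<in>{w. length w = t \<and> P w}. (1 / 2) ^ t)"
    by (intro sum.cong) (auto simp: measure_cylinder)
  finally show ?thesis by (simp add: power_one_over)
qed

text \<open>
  The words of a prefix-free set \<open>D\<close> that generates \<open>U\<close> cut a sequence into blocks, and what
  follows a block is independent of it.
\<close>

lemma measure_blocks:
  assumes prefix_free: "\<And>x v w. v \<in> D \<Longrightarrow> w \<in> D \<Longrightarrow> x \<in> cylinder v \<Longrightarrow> x \<in> cylinder w \<Longrightarrow> v = w"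
    and R: "R \<in> sets \<mu>"
  shows "measure \<mu> (\<Union>w\<in>D. {x \<in> cylinder w. drop_seq (length w) x \<in> R}) =
     measure \<mu> (\<Union>w\<in>D. cylinder w) * measure \<mu> R"
proof -
  let ?A = "\<lambda>R w. {x \<in> cylinder w. drop_seq (length w) x \<in> R}"
  \<comment> \<open>Indexing by word codes, with empty sets for words outside \<open>D\<close>,
    yields a sequence to which countable additivity applies.\<close>
  let ?F = "\<lambda>R n. if word_of n \<in> D then ?A R (word_of n) else {}"
  have sets: "?A R w \<in> sets \<mu>" if "R \<in> sets \<mu>" for R w
    using sets.Int[OF sets_cylinder[of w] vimage_in_sets_mu[OF measurable_drop_seq[of "length w"] that]]
    by (simp add: Int_def)
  have sums: "(\<lambda>n. of_bool (word_of n \<in> D) * ((1 / 2) ^ length (word_of n)) * measure \<mu> R) sums measure \<mu> (\<Union>w\<in>D. ?A R w)"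
    if R: "R \<in> sets \<mu>" for R
  proof -
    have "disjoint_family (?F R)"
      unfolding disjoint_family_on_def
    proof (intro ballI impI)
      fix m n :: nat assume "m \<noteq> n"
      then have "word_of m \<noteq> word_of n" by (metis word_code_word_of)
      then show "?F R m \<inter> ?F R n = {}" using prefix_free[of "word_of m" "word_of n"] by auto
    qed
    then have "(\<lambda>n. measure \<mu> (?F R n)) sums measure \<mu> (\<Union>n. ?F R n)"
      using sets[OF R] by (intro mu.finite_measure_UNION) auto
    moreover have "(\<Union>n. ?F R n) = (\<Union>w\<in>D. ?A R w)"
    proof (intro set_eqI iffI)
      fix x assume "x \<in> (\<Union>w\<in>D. ?A R w)"
      then obtain w where "w \<in> D" "x \<in> ?A R w" by blast
      then have "x \<in> ?F R (word_code w)" by simp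
      then show "x \<in> (\<Union>n. ?F R n)" by blast
    qed (auto split: if_splits)
    moreover have "measure \<mu> (?F R n) = of_bool (word_of n \<in> D) * ((1 / 2) ^ length (word_of n)) * measure \<mu> R" for n
      using measure_cylinder_drop_seq[OF R] by simp
    ultimately show ?thesis by simp
  qed
  \<comment> \<open>The series for \<open>R = UNIV\<close> sums to the measure of the union of the
    cylinders; multiplied by the measure of \<open>R\<close> it is the series for
    \<open>R\<close>.\<close>
  have "(\<lambda>n. of_bool (word_of n \<in> D) * ((1 / 2) ^ length (word_of n)) * measure \<mu> R) sums
      (measure \<mu> (\<Union>w\<in>D. cylinder w) * measure \<mu> R)"
    using sums_mult2[OF sums[of UNIV], of "measure \<mu> R"] sets.top[of \<mu>] mu.prob_space by simp
  with sums[OF R] show ?thesis by (rule sums_unique2)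
qed

section \<open>Weihrauch reducibility\<close>

text \<open>Composition of functionals: queries to the intermediate sequence are answered by
  recomputing its entries from the original input.\<close>

primrec qsubst :: "prog \<Rightarrow> prog \<Rightarrow> prog" where
  "qsubst d Zero = Zero"
| "qsubst d Succ = Succ"
| "qsubst d Fst = Fst"
| "qsubst d Snd = Snd"
| "qsubst d Query = d"
| "qsubst d (Tup a b) = Tup (qsubst d a) (qsubst d b)"
| "qsubst d (Comp a b) = Comp (qsubst d a) (qsubst d b)"
| "qsubst d (PrimRec a b) = PrimRec (qsubst d a) (qsubst d b)"
| "qsubst d (Mu a) = Mu (qsubst d a)"

lemma eval_qsubst:
  assumes "\<And>n. eval s d n = Some (s' n)"
  shows "eval s (qsubst d c) = eval s' c"
  by (induction c) (rule ext, simp add: assms)+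

lemma compute_eq_Some_iff: "compute c s = Some r \<longleftrightarrow> (\<forall>n. eval s c n = Some (r n))"
  by (auto simp: compute_def fun_eq_iff) (metis option.sel, metis option.distinct(1))

lemma map_le_compute_iff:
  "F \<subseteq>\<^sub>m compute c \<longleftrightarrow> (\<forall>s r. F s = Some r \<longrightarrow> (\<forall>n. eval s c n = Some (r n)))"
  unfolding map_le_def dom_def compute_eq_Some_iff[symmetric] by force

lemma computable_total: "recf f \<Longrightarrow> computable (\<lambda>s. Some (f s))"
  unfolding computable_def map_le_compute_iff recf_def by auto

lemma computable_compute: "computable (compute c)"
  unfolding computable_def by (blast intro: map_le_refl)

lemma computable_bind:
  assumes "computable F" "computable G"
  shows "computable (\<lambda>s. Option.bind (F s) G)"
proof -
  from assms obtain c d where c: "F \<subseteq>\<^sub>m compute c" and d: "G \<subseteq>\<^sub>m compute d"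
    unfolding computable_def by blast
  have "eval s (qsubst c d) n = Some (r n)" if r: "Option.bind (F s) G = Some r" for s r n
  proof -
    from r obtain u where u: "F s = Some u" "G u = Some r" by (auto simp: bind_eq_Some_conv)
    have "eval s (qsubst c d) = eval u d"
      using c u by (intro eval_qsubst) (auto simp: map_le_compute_iff)
    then show ?thesis using d u by (auto simp: map_le_compute_iff)
  qed
  then show ?thesis unfolding computable_def map_le_compute_iff by blast
qed

lemma computable_bpair:
  assumes "computable F" "computable G"
  shows "computable (\<lambda>s. Option.bind (F s) (\<lambda>a. Option.bind (G s) (\<lambda>b. Some (bpair a b))))"
proof -
  from assms obtain c d where c: "F \<subseteq>\<^sub>m compute c" and d: "G \<subseteq>\<^sub>m compute d"
    unfolding computable_def by blast
  have "recf (\<lambda>s n. n div 2)" by (intro recf_intros)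
  then obtain h where h: "eval s h n = Some (n div 2)" for s n unfolding recf_def by blast
  have "recf (\<lambda>s z. if even (p1 z) then p1 (p2 z) else p2 (p2 z))" by (intro recf_intros)
  then obtain k where k: "eval s k z = Some (if even (p1 z) then p1 (p2 z) else p2 (p2 z))" for s z
    unfolding recf_def by blast
  have "recf (\<lambda>s x. x)" by (rule recf_id)
  then obtain i where i: "eval s i x = Some x" for s x unfolding recf_def by blast
  let ?e = "Comp k (Tup i (Tup (Comp c h) (Comp d h)))"
  have "eval s ?e n = Some (bpair a b n)" if "F s = Some a" "G s = Some b" for s a b n
    using c d that by (auto simp: map_le_compute_iff h i k bpair_def)
  then show ?thesis unfolding computable_def map_le_compute_iff
    by (intro exI[of _ ?e]) (auto simp: bind_eq_Some_conv)
qed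

lemma bfst_bpair [simp]: "bfst (bpair p q) = p"
  by (simp add: bfst_def bpair_def)

lemma bsnd_bpair [simp]: "bsnd (bpair p q) = q"
  by (simp add: bsnd_def bpair_def)

lemma recf_bfst: "recf f \<Longrightarrow> recf (\<lambda>s x. bfst s (f s x))"
  unfolding bfst_def by (intro recf_intros)

lemma recf_bsnd: "recf f \<Longrightarrow> recf (\<lambda>s x. bsnd s (f s x))"
  unfolding bsnd_def by (intro recf_intros)

lemma weihrauch_le_trans:
  assumes "f \<le>\<^sub>W g" "g \<le>\<^sub>W h"
  shows "f \<le>\<^sub>W h"
proof -
  let ?R = "\<lambda>K H G p. Option.bind (Option.bind (H p) G) (\<lambda>r. K (bpair p r))"
  from assms(1) obtain K1 H1 where 1: "computable K1" "computable H1"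
    "\<And>G. realizes G g \<Longrightarrow> realizes (?R K1 H1 G) f"
    unfolding weihrauch_le_def by blast
  from assms(2) obtain K2 H2 where 2: "computable K2" "computable H2"
    "\<And>G. realizes G h \<Longrightarrow> realizes (?R K2 H2 G) g"
    unfolding weihrauch_le_def by blast
  define H where "H = (\<lambda>s. Option.bind (H1 s) H2)"
  \<comment> \<open>For input \<open>bpair p w\<close> with \<open>w\<close> the answer of
    \<open>G\<close>, \<open>L\<close> yields the pair of \<open>H1 p\<close> and \<open>w\<close>.
    From it \<open>K2\<close> makes an answer to the instance \<open>H1 p\<close> of
    \<open>g\<close>, which \<open>M\<close> pairs with \<open>p\<close> for
    \<open>K1\<close>.\<close>
  define L where "L = (\<lambda>s. Option.bind (Option.bind (Some (bfst s)) H1) (\<lambda>a. Option.bind (Some (bsnd s)) (\<lambda>b. Some (bpair a b))))"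
  define M where "M = (\<lambda>s. Option.bind (Some (bfst s)) (\<lambda>a. Option.bind (Option.bind (L s) K2) (\<lambda>b. Some (bpair a b))))"
  define K where "K = (\<lambda>s. Option.bind (M s) K1)"
  have fst: "computable (\<lambda>s. Some (bfst s))" and snd: "computable (\<lambda>s. Some (bsnd s))"
    by (rule computable_total, intro recf_intros recf_bfst recf_bsnd)+
  have H: "computable H" unfolding H_def by (intro computable_bind 1 2)
  have "computable L" unfolding L_def by (intro computable_bpair computable_bind fst snd 1)
  then have "computable M" unfolding M_def by (intro computable_bpair computable_bind fst 2)
  then have K: "computable K" unfolding K_def by (intro computable_bind 1)
  have "realizes (?R K H G) f" if G: "realizes G h" for G
    unfolding realizes_def
  proof (intro allI impI)
    fix p x assume "src f p = Some x \<and> x \<in> mdom (fn f)"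
    with 1(3)[OF 2(3)[OF G]] obtain r y where r: "?R K1 H1 (?R K2 H2 G) p = Some r"
      and y: "tgt f r = Some y" "y \<in> fn f x"
      unfolding realizes_def by blast
    from r obtain u v w t where "H1 p = Some u" "H2 u = Some v" "G v = Some w"
      "K2 (bpair u w) = Some t" "K1 (bpair p t) = Some r"
      by (auto simp: bind_eq_Some_conv)
    then have "?R K H G p = Some r" by (simp add: K_def H_def L_def M_def)
    with y show "\<exists>r y. ?R K H G p = Some r \<and> tgt f r = Some y \<and> y \<in> fn f x" by blast
  qed
  with K H show ?thesis unfolding weihrauch_le_def by blast
qed

section \<open>Closed sets as sets of paths\<close>

lemma open_cylinder: "open (cylinder w)"
proof -
  have "cylinder w = (\<Inter>i\<in>{..<length w}. (\<lambda>x. x i) -` {w ! i})"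
    by (auto simp: cylinder_def)
  moreover have "open ((\<lambda>x :: cantor. x i) -` {b})" for i b
    using continuous_on_open_vimage[OF open_UNIV, of "\<lambda>x :: cantor. x i"] by (simp add: discrete_topology_class.open_discrete)
  ultimately show ?thesis by (simp add: open_INT)
qed

lemma paths_eq: "paths T = - (\<Union>w\<in>{w. w \<notin> T}. cylinder w)"
proof (rule set_eqI)
  fix x
  have "x \<in> (\<Union>w\<in>{w. w \<notin> T}. cylinder w) \<longleftrightarrow> (\<exists>n. map x [0..<n] \<notin> T)"
    unfolding UN_iff Bex_def mem_Collect_eq mem_cylinder_iff
    by (metis length_map length_upt minus_nat.diff_0)
  then show "x \<in> paths T \<longleftrightarrow> x \<in> - (\<Union>w\<in>{w. w \<notin> T}. cylinder w)"
    unfolding paths_def Compl_iff by blast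
qed

lemma closed_paths: "closed (paths T)"
  unfolding paths_eq using open_cylinder by (auto simp: closed_def)

lemma src_implication [simp]: "src (g \<rightarrow>\<^sub>W f) = src f"
  and tgt_implication [simp]: "tgt (g \<rightarrow>\<^sub>W f) = prod_rep (mvf_rep (tgt g) (tgt f)) (src g)"
  by (simp_all add: implication_def)

lemma mem_implication_iff:
  "Hx \<in> fn (g \<rightarrow>\<^sub>W f) u \<longleftrightarrow> u \<in> mdom (fn f) \<and> fst Hx \<in> ran (mvf_rep (tgt g) (tgt f)) \<and>
     snd Hx \<in> mdom (mcomp (fst Hx) (fn g)) \<and> mcomp (fst Hx) (fn g) (snd Hx) \<subseteq> fn f u"
  by (cases Hx) (simp add: implication_def)

lemma mdom_implicationD: "u \<in> mdom (fn (g \<rightarrow>\<^sub>W f)) \<Longrightarrow> u \<in> mdom (fn f)"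
  using mem_implication_iff by (fastforce simp: mdom_def)

lemma fn_PC: "fn PC_cantor A = (if measure \<mu> A > 0 \<and> closed A then A else {})"
  by (simp add: PC_cantor_def C_cantor_def closed_choice_def)

lemma PC_simps [simp]: "src PC_cantor = closed_cantor_rep" "tgt PC_cantor = cantor_rep"
  by (simp_all add: PC_cantor_def C_cantor_def)

lemma WWKL_simps [simp]: "src WWKL = tree_rep" "tgt WWKL = cantor_rep"
  by (simp_all add: WWKL_def)

lemma C_nat_simps [simp]: "src C_nat = closed_nat_rep" "tgt C_nat = nat_rep" "fn C_nat = (\<lambda>A. A)"
  by (simp_all add: C_nat_def closed_choice_def fun_eq_iff closed_def discrete_topology_class.open_discrete)

lemma MLR_simps [simp]: "src MLR = cantor_rep" "tgt MLR = cantor_rep" "fn MLR = (\<lambda>p. {q. ml_random p q})"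
  by (simp_all add: MLR_def)

lemma fn_WWKL_eq_PC:
  assumes "T \<in> mdom (fn WWKL)"
  shows "fn WWKL T = paths T" "fn PC_cantor (paths T) = paths T" "paths T \<in> mdom (fn PC_cantor)"
  using assms closed_paths by (auto simp: fn_PC WWKL_def mdom_def split: if_splits)

text \<open>Places of a tree name are word codes, so enumerating the places where it is not 1 gives
  a negative name of the set of paths. The two implications have equal values there, and the answer
  is passed on unchanged.\<close>

lemma implication_WWKL_le_PC: "(C_nat \<rightarrow>\<^sub>W WWKL) \<le>\<^sub>W (C_nat \<rightarrow>\<^sub>W PC_cantor)"
proof -
  define H where "H = (\<lambda>p :: baire. \<lambda>n. if p n = 1 then 0 else Suc n)"
  have "computable (\<lambda>s. Some (H s))"
    unfolding H_def by (rule computable_total) (intro recf_intros)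
  moreover have "computable (\<lambda>s. Some (bsnd s))"
    by (rule computable_total) (intro recf_intros recf_bsnd)
  moreover have "realizes (\<lambda>p. Option.bind (Option.bind (Some (H p)) G) (\<lambda>r. Some (bsnd (bpair p r)))) (C_nat \<rightarrow>\<^sub>W WWKL)"
    if G: "realizes G (C_nat \<rightarrow>\<^sub>W PC_cantor)" for G
    unfolding realizes_def
  proof (intro allI impI)
    fix p T assume "src (C_nat \<rightarrow>\<^sub>W WWKL) p = Some T \<and> T \<in> mdom (fn (C_nat \<rightarrow>\<^sub>W WWKL))"
    then have p: "tree_rep p = Some T" and dom: "T \<in> mdom (fn (C_nat \<rightarrow>\<^sub>W WWKL))" by auto
    note T = mdom_implicationD[OF dom]
    have "Suc (word_code w) \<in> range (H p) \<longleftrightarrow> w \<notin> T" for w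
    proof -
      have "Suc (word_code w) \<in> range (H p) \<longleftrightarrow> p (word_code w) \<noteq> 1"
        by (auto simp: H_def image_iff)
      then show ?thesis using p by (auto simp: tree_rep_def Let_def split: if_splits)
    qed
    then have src: "closed_cantor_rep (H p) = Some (paths T)"
      by (simp add: closed_cantor_rep_def paths_eq)
    have eq: "fn (C_nat \<rightarrow>\<^sub>W PC_cantor) (paths T) = fn (C_nat \<rightarrow>\<^sub>W WWKL) T"
      using fn_WWKL_eq_PC[OF T] T by (auto simp: mem_implication_iff)
    then have "paths T \<in> mdom (fn (C_nat \<rightarrow>\<^sub>W PC_cantor))" using dom by (simp add: mdom_def)
    then obtain r y where "G (H p) = Some r" "tgt (C_nat \<rightarrow>\<^sub>W PC_cantor) r = Some y"
      "y \<in> fn (C_nat \<rightarrow>\<^sub>W PC_cantor) (paths T)"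
      using G src unfolding realizes_def by force
    then show "\<exists>r y. Option.bind (Option.bind (Some (H p)) G) (\<lambda>r. Some (bsnd (bpair p r))) = Some r \<and>
        tgt (C_nat \<rightarrow>\<^sub>W WWKL) r = Some y \<and> y \<in> fn (C_nat \<rightarrow>\<^sub>W WWKL) T"
      using eq by (simp del: split_paired_Ex)
  qed
  ultimately show ?thesis unfolding weihrauch_le_def by blast
qed

section \<open>Programs as names of functions from natural numbers to Cantor space\<close>

lemma mcomp_mv_of:
  "mcomp (mv_of F) g x = {z. g x \<noteq> {} \<and> (\<forall>y\<in>g x. F y \<noteq> None) \<and> (\<exists>y\<in>g x. F y = Some z)}"
  unfolding mcomp_def mdom_def mv_of_def by (auto simp: subset_iff)

text \<open>In the cylinder representation the names of \<open>n\<close> are all sequences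
  \<open>t\<close> that begin with \<open>n\<close>. The program has to succeed on every one of
  them, and the results may differ.\<close>

lemma mem_Phi_mv_iff:
  "z \<in> Phi_mv nat_rep cantor_rep h n \<longleftrightarrow>
     (\<forall>t. t 0 = n \<longrightarrow> (\<exists>r y. Phi h t = Some r \<and> cantor_rep r = Some y)) \<and>
     (\<exists>t r. t 0 = n \<and> Phi h t = Some r \<and> cantor_rep r = Some z)"
proof -
  let ?A = "mcomp (mv_of (Phi h)) (mv_inverse (cyl_rep nat_rep)) n"
  have "mv_inverse (cyl_rep nat_rep) n = {t. t 0 = n}"
    by (simp add: mv_inverse_def cyl_rep_def nat_rep_def bfst_def)
  moreover have "(\<lambda>_. n) \<in> {t :: baire. t 0 = n}" by simp
  ultimately have A: "r \<in> ?A \<longleftrightarrow> (\<forall>t. t 0 = n \<longrightarrow> (\<exists>r. Phi h t = Some r)) \<and> (\<exists>t. t 0 = n \<and> Phi h t = Some r)" for r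
    unfolding mcomp_mv_of not_None_eq by blast
  have Phi: "z \<in> Phi_mv nat_rep cantor_rep h n \<longleftrightarrow>
      (\<forall>r\<in>?A. \<exists>y. cantor_rep r = Some y) \<and> (\<exists>r\<in>?A. cantor_rep r = Some z)"
    unfolding Phi_mv_def mcomp_mv_of[of cantor_rep] not_None_eq by blast
  show ?thesis
  proof
    assume "z \<in> Phi_mv nat_rep cantor_rep h n"
    then obtain r where r: "r \<in> ?A" "cantor_rep r = Some z" and all: "\<forall>r\<in>?A. \<exists>y. cantor_rep r = Some y"
      unfolding Phi by blast
    have "\<exists>r y. Phi h t = Some r \<and> cantor_rep r = Some y" if t: "t 0 = n" for t
    proof -
      from r(1) t obtain r' where r': "Phi h t = Some r'" unfolding A by blast
      then have "r' \<in> ?A" using r(1) t unfolding A by blast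
      with all r' show ?thesis by blast
    qed
    with r show "(\<forall>t. t 0 = n \<longrightarrow> (\<exists>r y. Phi h t = Some r \<and> cantor_rep r = Some y)) \<and>
        (\<exists>t r. t 0 = n \<and> Phi h t = Some r \<and> cantor_rep r = Some z)"
      unfolding A by blast
  next
    assume asm: "(\<forall>t. t 0 = n \<longrightarrow> (\<exists>r y. Phi h t = Some r \<and> cantor_rep r = Some y)) \<and>
        (\<exists>t r. t 0 = n \<and> Phi h t = Some r \<and> cantor_rep r = Some z)"
    then obtain t r where "t 0 = n" "Phi h t = Some r" "cantor_rep r = Some z" by blast
    then have "r \<in> ?A" using asm unfolding A by blast
    moreover have "\<exists>y. cantor_rep r = Some y" if "r \<in> ?A" for r
      using that asm unfolding A by force
    ultimately show "z \<in> Phi_mv nat_rep cantor_rep h n"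
      unfolding Phi using \<open>cantor_rep r = Some z\<close> by blast
  qed
qed

lemma cantor_rep_eq_Some_iff: "cantor_rep p = Some b \<longleftrightarrow> p = (\<lambda>i. of_bool (b i))"
proof
  assume "cantor_rep p = Some b"
  then have p: "range p \<subseteq> {0, 1}" and b: "b = (\<lambda>i. p i = 1)"
    by (auto simp: cantor_rep_def split: if_splits)
  have "p i = of_bool (b i)" for i
    using range_subsetD[OF p, of i] by (auto simp: b)
  then show "p = (\<lambda>i. of_bool (b i))" by blast
qed (auto simp: cantor_rep_def)

lemma realizesD:
  assumes "realizes F f" "src f p = Some x" "x \<in> mdom (fn f)"
  shows "\<exists>r y. F p = Some r \<and> tgt f r = Some y \<and> y \<in> fn f x"
  using assms unfolding realizes_def by blast

lemma Phi_mv_eq_singleton: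
  assumes Phi: "\<And>t. t 0 = n \<Longrightarrow> Phi h t = Some r" and z: "cantor_rep r = Some z"
  shows "Phi_mv nat_rep cantor_rep h n = {z}"
proof (intro set_eqI iffI)
  fix x assume "x \<in> Phi_mv nat_rep cantor_rep h n"
  then obtain t r' where t: "t 0 = n" "Phi h t = Some r'" "cantor_rep r' = Some x"
    unfolding mem_Phi_mv_iff by blast
  with Phi[of t, OF t(1)] z show "x \<in> {z}" by simp
next
  fix x assume "x \<in> {z}"
  moreover have "Phi h (\<lambda>_. n) = Some r" by (rule Phi) simp
  ultimately have "\<exists>t r. t 0 = n \<and> Phi h t = Some r \<and> cantor_rep r = Some x"
    using z by (intro exI[of _ "\<lambda>_. n"] exI[of _ r]) simp
  moreover have "\<exists>r y. Phi h t = Some r \<and> cantor_rep r = Some y" if "t 0 = n" for t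
    using Phi[of t, OF that] z by simp
  ultimately show "x \<in> Phi_mv nat_rep cantor_rep h n" unfolding mem_Phi_mv_iff by blast
qed

text \<open>One fixed program serves all \<open>y\<close>, which is carried as the parameter part of
  the name.\<close>

lemma shift_function:
  "\<exists>k. \<forall>y n. Phi_mv nat_rep cantor_rep (\<lambda>i. if i = 0 then k else of_bool (y (i - 1))) n = {drop_seq n y}"
proof -
  \<comment> \<open>In the paired oracle the number \<open>n\<close> stands at place 1, and bit
    \<open>j\<close> of \<open>y\<close> at place \<open>2 * Suc j\<close>, because the program code
    occupies place 0.\<close>
  have "recf (\<lambda>s i. s (2 * Suc (s 1 + i)))" by (intro recf_intros)
  then obtain c where c: "\<And>s i. eval s c i = Some (s (2 * Suc (s 1 + i)))" unfolding recf_def by blast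
  have "Phi_mv nat_rep cantor_rep (\<lambda>i. if i = 0 then prog_code c else of_bool (y (i - 1))) n = {drop_seq n y}"
    for y n
  proof (rule Phi_mv_eq_singleton)
    let ?h = "\<lambda>i. if i = 0 then prog_code c else of_bool (y (i - 1))"
    show "Phi ?h t = Some (\<lambda>i. of_bool (y (n + i)))" if "t 0 = n" for t
    proof -
      have "bpair ?h t 0 = prog_code c" by (simp add: bpair_def)
      moreover have "compute c (bpair ?h t) = Some (\<lambda>i. of_bool (y (n + i)))"
        unfolding compute_eq_Some_iff c using that by (simp add: bpair_def)
      ultimately show ?thesis by (simp add: Phi_def universal_def inj_prog_code)
    qed
    show "cantor_rep (\<lambda>i. of_bool (y (n + i))) = Some (drop_seq n y)"
      by (simp add: cantor_rep_eq_Some_iff drop_seq_def)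
  qed
  then show ?thesis by blast
qed

lemma mcomp_id: "mcomp H (\<lambda>A. A) A = (if A \<noteq> {} \<and> A \<subseteq> mdom H then \<Union> (H ` A) else {})"
  by (auto simp: mcomp_def mdom_def)

lemma mem_C_nat_implication_iff:
  assumes "tgt f = cantor_rep"
  shows "(H, A) \<in> fn (C_nat \<rightarrow>\<^sub>W f) u \<longleftrightarrow>
    u \<in> mdom (fn f) \<and> H \<in> range (Phi_mv nat_rep cantor_rep) \<and> A \<noteq> {} \<and> A \<subseteq> mdom H \<and>
    \<Union> (H ` A) \<subseteq> fn f u"
proof -
  have "ran (mvf_rep nat_rep cantor_rep) = range (Phi_mv nat_rep cantor_rep)"
    by (auto simp: ran_def mvf_rep_def)
  moreover have "A \<in> mdom (mcomp H (\<lambda>A. A)) \<longleftrightarrow> A \<noteq> {} \<and> A \<subseteq> mdom H"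
    unfolding mdom_def[of "mcomp H (\<lambda>A. A)"] mcomp_id by (auto simp: mdom_def)
  ultimately show ?thesis
    unfolding mem_implication_iff using assms by (auto simp: mcomp_id)
qed

text \<open>The domain consists of the points with nonempty value, so an answer has to be exhibited:
  the set \<open>{0}\<close> with a function whose value at \<open>0\<close> is a solution.\<close>

lemma mem_mdom_C_nat_implication:
  assumes "tgt f = cantor_rep" "u \<in> mdom (fn f)"
  shows "u \<in> mdom (fn (C_nat \<rightarrow>\<^sub>W f))"
proof -
  from assms(2) obtain y where y: "y \<in> fn f u" by (auto simp: mdom_def)
  obtain h where h: "Phi_mv nat_rep cantor_rep h 0 = {drop_seq 0 y}"
    using shift_function by blast
  have "drop_seq 0 y = y" by (simp add: drop_seq_def)
  then have "(Phi_mv nat_rep cantor_rep h, {0}) \<in> fn (C_nat \<rightarrow>\<^sub>W f) u"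
    unfolding mem_C_nat_implication_iff[OF assms(1)] using assms(2) y h by (simp add: mdom_def)
  then show ?thesis unfolding mdom_def by blast
qed

section \<open>Random sequences have tails in closed sets of positive measure\<close>

text \<open>
  Here the oracle \<open>s\<close> is the graph of an enumeration of words; \<open>w\<close> is bad if it is covered by
  a word that is enumerated before stage \<open>length w\<close>. The cutoff makes badness decidable.
\<close>

definition bad :: "baire \<Rightarrow> bool list \<Rightarrow> bool" where
  "bad s w \<longleftrightarrow> (\<exists>i\<le>length w. \<exists>l\<le>length w. s (pr i (Suc (word_code (take l w)))) = 1)"

lemma bad_append: "bad s v \<Longrightarrow> bad s (v @ w)"
proof -
  assume "bad s v"
  then obtain i l where "i \<le> length v" "l \<le> length v" "s (pr i (Suc (word_code (take l v)))) = 1"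
    unfolding bad_def by blast
  then show ?thesis unfolding bad_def by (intro exI[of _ i] conjI exI[of _ l]) auto
qed

text \<open>A block is the shortest bad prefix. These prefixes form the prefix-free set
  \<open>min_bad\<close>, to which \<open>measure_blocks\<close> applies.\<close>

primrec blocks :: "baire \<Rightarrow> nat \<Rightarrow> bool list \<Rightarrow> bool" where
  "blocks s 0 w \<longleftrightarrow> True"
| "blocks s (Suc m) w \<longleftrightarrow> bad s w \<and> blocks s m (drop (LEAST l. bad s (take l w)) w)"

definition bad_set :: "baire \<Rightarrow> cantor set" where
  "bad_set s = {x. \<exists>n. bad s (map x [0..<n])}"

definition blocks_set :: "baire \<Rightarrow> nat \<Rightarrow> cantor set" where
  "blocks_set s m = {x. \<exists>n. blocks s m (map x [0..<n])}"

definition min_bad :: "baire \<Rightarrow> bool list set" where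
  "min_bad s = {w. bad s w \<and> (\<forall>l<length w. \<not> bad s (take l w))}"

lemma map_upt_add: "map x [0..<n + k] = map x [0..<n] @ map (drop_seq n x) [0..<k]"
  by (rule nth_equalityI) (auto simp: nth_append drop_seq_def)

lemma min_bad_prefix_free:
  assumes "v \<in> min_bad s" "w \<in> min_bad s" "x \<in> cylinder v" "x \<in> cylinder w"
  shows "v = w"
proof -
  have v: "v = map x [0..<length v]" and w: "w = map x [0..<length w]"
    using assms(3,4) unfolding mem_cylinder_iff by simp_all
  have take: "take k (map x [0..<n]) = map x [0..<k]" if "k \<le> n" for k n
    using that by (simp add: take_map)
  have "v = take (length v) w" if "length v \<le> length w"
    using take[OF that] v w by simp
  moreover have "w = take (length w) v" if "length w \<le> length v"
    using take[OF that] v w by simp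
  moreover have "\<not> length v < length w \<or> take (length v) w \<noteq> v" "\<not> length w < length v \<or> take (length w) v \<noteq> w"
    using assms(1,2) unfolding min_bad_def by auto
  ultimately show ?thesis by (cases "length v" "length w" rule: linorder_cases) auto
qed

lemma bad_set_eq: "bad_set s = (\<Union>w\<in>min_bad s. cylinder w)"
proof (intro set_eqI iffI)
  fix x assume "x \<in> bad_set s"
  then have ex: "\<exists>n. bad s (map x [0..<n])" by (simp add: bad_set_def)
  define n where "n = (LEAST n. bad s (map x [0..<n]))"
  have "bad s (map x [0..<n])" unfolding n_def by (rule LeastI_ex[OF ex])
  moreover have "\<not> bad s (map x [0..<l])" if "l < n" for l
    using that not_less_Least unfolding n_def by blast
  ultimately have "map x [0..<n] \<in> min_bad s"
    by (simp add: min_bad_def take_map)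
  moreover have "x \<in> cylinder (map x [0..<n])" by (simp add: mem_cylinder_iff)
  ultimately show "x \<in> (\<Union>w\<in>min_bad s. cylinder w)" by blast
next
  fix x assume "x \<in> (\<Union>w\<in>min_bad s. cylinder w)"
  then obtain w where "w \<in> min_bad s" "x \<in> cylinder w" by blast
  then show "x \<in> bad_set s" unfolding min_bad_def bad_set_def mem_cylinder_iff
    by (metis (mono_tags, lifting) mem_Collect_eq)
qed

lemma blocks_set_0: "blocks_set s 0 = UNIV"
  by (simp add: blocks_set_def)

text \<open>The shortest bad prefix of a long finite part of \<open>x\<close> is that of
  \<open>x\<close> itself, so cutting finite words agrees with cutting sequences.\<close>

lemma blocks_set_Suc:
  "blocks_set s (Suc m) = (\<Union>w\<in>min_bad s. {x \<in> cylinder w. drop_seq (length w) x \<in> blocks_set s m})"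
proof (intro set_eqI iffI)
  fix x assume "x \<in> blocks_set s (Suc m)"
  then obtain n where n: "blocks s (Suc m) (map x [0..<n])" by (auto simp: blocks_set_def)
  define l where "l = (LEAST l. bad s (take l (map x [0..<n])))"
  have bn: "bad s (take n (map x [0..<n]))" using n by simp
  have "l \<le> n" unfolding l_def by (rule Least_le[of "\<lambda>l. bad s (take l (map x [0..<n]))", OF bn])
  have take: "take k (map x [0..<n]) = map x [0..<k]" if "k \<le> l" for k
    using that \<open>l \<le> n\<close> by (simp add: take_map)
  have "bad s (take l (map x [0..<n]))"
    unfolding l_def by (rule LeastI[of "\<lambda>l. bad s (take l (map x [0..<n]))", OF bn])
  then have 1: "bad s (map x [0..<l])" using take by simp
  have 2: "\<not> bad s (map x [0..<k])" if "k < l" for k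
    using not_less_Least[of k "\<lambda>l. bad s (take l (map x [0..<n]))"] that take[of k] l_def by simp
  have "map x [0..<l] \<in> min_bad s"
    using 1 2 by (simp add: min_bad_def take_map)
  moreover have "x \<in> cylinder (map x [0..<l])" by (simp add: mem_cylinder_iff)
  moreover have "drop l (map x [0..<n]) = map (drop_seq l x) [0..<n - l]"
    using map_upt_add[of x l "n - l"] \<open>l \<le> n\<close> by simp
  then have "drop_seq l x \<in> blocks_set s m" 
    using n[unfolded blocks.simps, folded l_def] unfolding blocks_set_def by auto
  ultimately show "x \<in> (\<Union>w\<in>min_bad s. {x \<in> cylinder w. drop_seq (length w) x \<in> blocks_set s m})"
    by (intro UN_I[of "map x [0..<l]"]) auto
next
  fix x assume "x \<in> (\<Union>w\<in>min_bad s. {x \<in> cylinder w. drop_seq (length w) x \<in> blocks_set s m})"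
  then obtain w where w: "bad s w" "\<forall>l<length w. \<not> bad s (take l w)" "map x [0..<length w] = w"
    "drop_seq (length w) x \<in> blocks_set s m"
    unfolding min_bad_def by (auto simp: mem_cylinder_iff)
  then obtain k where k: "blocks s m (map (drop_seq (length w) x) [0..<k])"
    by (auto simp: blocks_set_def)
  let ?v = "map (drop_seq (length w) x) [0..<k]"
  have eq: "map x [0..<length w + k] = w @ ?v" using map_upt_add[of x "length w" k] w(3) by simp
  have "(LEAST l. bad s (take l (w @ ?v))) = length w"
  proof (rule Least_equality)
    show "bad s (take (length w) (w @ ?v))" using w(1) by simp
    show "length w \<le> l" if "bad s (take l (w @ ?v))" for l
      using that w(2) by (cases "l < length w") auto
  qed
  then have "blocks s (Suc m) (map x [0..<length w + k])"
    unfolding eq using k bad_append[OF w(1)] by simp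
  then show "x \<in> blocks_set s (Suc m)" unfolding blocks_set_def by blast
qed

lemma Collect_Ex_prefix_eq: "{x. \<exists>n. P (map x [0..<n])} = (\<Union>w\<in>{w. P w}. cylinder w)"
proof (intro set_eqI iffI)
  fix x assume "x \<in> {x. \<exists>n. P (map x [0..<n])}"
  then obtain n where "map x [0..<n] \<in> {w. P w}" by blast
  moreover have "x \<in> cylinder (map x [0..<n])" by (simp add: mem_cylinder_iff)
  ultimately show "x \<in> (\<Union>w\<in>{w. P w}. cylinder w)" by blast
next
  fix x assume "x \<in> (\<Union>w\<in>{w. P w}. cylinder w)"
  then obtain w where "P w" "map x [0..<length w] = w" unfolding mem_cylinder_iff[symmetric] by blast
  then show "x \<in> {x. \<exists>n. P (map x [0..<n])}" by (metis mem_Collect_eq)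
qed

lemma sets_UN_cylinder: "(\<Union>w\<in>W. cylinder w) \<in> sets \<mu>"
  by (rule sets.countable_UN'') (simp_all add: sets_cylinder)

lemma sets_blocks_set: "blocks_set s m \<in> sets \<mu>"
  unfolding blocks_set_def Collect_Ex_prefix_eq by (rule sets_UN_cylinder)

lemma measure_blocks_set: "measure \<mu> (blocks_set s m) = measure \<mu> (bad_set s) ^ m"
proof (induction m)
  case 0
  then show ?case using mu.prob_space by (simp add: blocks_set_0)
next
  case (Suc m)
  then show ?case unfolding blocks_set_Suc bad_set_eq
    by (subst measure_blocks[OF min_bad_prefix_free sets_blocks_set]) auto
qed

lemma drop_seq_drop_seq: "drop_seq m (drop_seq n x) = drop_seq (n + m) x"
  by (simp add: drop_seq_def add.assoc)

text \<open>The tail that follows a block satisfies the hypothesis again, so blocks can be cut off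
  indefinitely.\<close>

lemma mem_blocks_setI: "(\<And>n. drop_seq n x \<in> bad_set s) \<Longrightarrow> x \<in> blocks_set s m"
proof (induction m arbitrary: x)
  case 0
  then show ?case by (simp add: blocks_set_0)
next
  case (Suc m)
  have "drop_seq 0 x = x" by (simp add: drop_seq_def)
  then have "x \<in> bad_set s" using Suc.prems[of 0] by simp
  then obtain w where w: "w \<in> min_bad s" "x \<in> cylinder w" unfolding bad_set_eq by blast
  have "drop_seq (length w) x \<in> blocks_set s m"
    by (rule Suc.IH) (simp add: drop_seq_drop_seq Suc.prems)
  with w show ?case unfolding blocks_set_Suc by blast
qed

lemma recf_bad: "recf f \<Longrightarrow> recf (\<lambda>s x. of_bool (bad s (word_of (f s x))))"
proof (rule recf_comp[where g="\<lambda>s x. of_bool (bad s (word_of x))"])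
  have "bad s (word_of c) \<longleftrightarrow> (\<exists>i<Suc (length (word_of c)). \<exists>l<Suc (length (word_of c)).
      s (pr i (Suc (word_code (take l (word_of c))))) = 1)" for s c
    unfolding bad_def less_Suc_eq_le by (rule refl)
  then show "recf (\<lambda>s x. of_bool (bad s (word_of x)))"
    by (simp only:) (intro recf_intros)
qed

text \<open>One cut as an operation on numbers: the successor of a word code is a remaining word,
  \<open>0\<close> is failure and stays \<open>0\<close>. The sum is the minimum from
  \<open>sum_Least\<close>, and the detour through \<open>word_code\<close> fits the closure rules
  for \<open>take\<close> and \<open>drop\<close>.\<close>

definition next_code :: "baire \<Rightarrow> nat \<Rightarrow> nat" where
  "next_code s n =
     (if n \<noteq> 0 \<and> bad s (word_of (n - 1))
      then Suc (word_code (drop (\<Sum>i<length (word_of (n - 1)).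
             of_bool (\<forall>j<Suc i. \<not> bad s (word_of (word_code (take j (word_of (n - 1))))))) (word_of (n - 1))))
      else 0)"

lemma recf_next_code: "recf f \<Longrightarrow> recf (\<lambda>s x. next_code s (f s x))"
  by (rule recf_comp[where g=next_code]) (unfold next_code_def, intro recf_intros recf_bad)

lemma next_code_Suc:
  "next_code s (Suc (word_code w)) =
     (if bad s w then Suc (word_code (drop (LEAST l. bad s (take l w)) w)) else 0)"
  using sum_Least[of "\<lambda>l. bad s (take l w)" "length w" "length w"] by (simp add: next_code_def)

lemma blocks_iff: "blocks s m w \<longleftrightarrow> (next_code s ^^ m) (Suc (word_code w)) \<noteq> 0"
proof (induction m arbitrary: w)
  case (Suc m)
  have "(next_code s ^^ m) 0 = 0" by (induction m) (simp_all add: next_code_def)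
  then show ?case
    by (simp add: funpow_Suc_right next_code_Suc Suc.IH del: funpow.simps)
qed simp

lemma blocks_semidecidable:
  obtains c where "\<And>s n w. eval s c (pr n (word_code w)) \<noteq> None \<longleftrightarrow> blocks s (k * n) w"
proof -
  have rec: "(f ^^ m) x = rec_nat x (\<lambda>_. f) m" for f :: "nat \<Rightarrow> nat" and m x
    by (induction m) auto
  have "recf (\<lambda>s x. of_bool (\<not> (next_code s ^^ (k * p1 x)) (Suc (p2 x)) = 0))"
    unfolding rec by (intro recf_intros recf_next_code)
  then obtain c where "\<And>s x. eval s c x \<noteq> None \<longleftrightarrow> \<not> (next_code s ^^ (k * p1 x)) (Suc (p2 x)) = 0"
    by (rule recf_semidecidable) blast
  then have "eval s c (pr n (word_code w)) \<noteq> None \<longleftrightarrow> blocks s (k * n) w" for s n w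
    by (simp add: blocks_iff)
  then show ?thesis by (rule that)
qed

theorem ml_random_tail:
  assumes q: "ml_random b q" and s: "s = (\<lambda>i. of_bool (b i))" and U: "measure \<mu> (bad_set s) < 1"
  shows "\<exists>n. drop_seq n q \<notin> bad_set s"
proof (rule ccontr)
  assume "\<not> ?thesis"
  then have q_in: "q \<in> blocks_set s m" for m by (intro mem_blocks_setI) blast
  \<comment> \<open>With \<open>k\<close> blocks the measure is below one half, so
    \<open>k * n\<close> blocks meet the bound of test component \<open>n\<close>.\<close>
  obtain k where k: "measure \<mu> (bad_set s) ^ k < 1 / 2"
    using real_arch_pow_inv[of "1 / 2", OF _ U] by auto
  obtain c where c: "\<And>s n w. eval s c (pr n (word_code w)) \<noteq> None \<longleftrightarrow> blocks s (k * n) w"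
    using blocks_semidecidable by blast
  have "ml_test b (\<lambda>n. blocks_set s (k * n))"
    unfolding ml_test_def uniformly_ce_open_def
  proof (intro conjI exI[of _ c] allI)
    fix n
    show "blocks_set s (k * n) =
        (\<Union>w\<in>{w. eval (\<lambda>i. of_bool (b i)) c (pr n (word_code w)) \<noteq> None}. cylinder w)"
      unfolding c s[symmetric] blocks_set_def by (rule Collect_Ex_prefix_eq)
    show "measure \<mu> (blocks_set s (k * n)) \<le> (1 / 2) ^ n"
      unfolding measure_blocks_set power_mult using k by (intro power_mono) auto
  qed
  with q q_in show False unfolding ml_random_def by blast
qed

text \<open>\<open>MLR\<close> takes its input from Cantor space, while a name of a closed set lies
  in Baire space. The graph of the name is the binary oracle that replaces it.\<close>

lemma bad_set_graph:
  "bad_set (\<lambda>i. of_bool (p (p1 i) = p2 i)) = (\<Union>w\<in>{w. Suc (word_code w) \<in> range p}. cylinder w)"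
  (is "bad_set ?s = ?U")
proof (intro set_eqI iffI)
  fix x assume "x \<in> bad_set ?s"
  then obtain n i l where "l \<le> n" "p i = Suc (word_code (take l (map x [0..<n])))"
    unfolding bad_set_def bad_def by (auto simp: of_bool_def split: if_splits)
  then have "p i = Suc (word_code (map x [0..<l]))" by (simp add: take_map)
  then have "Suc (word_code (map x [0..<l])) \<in> range p" by (metis rangeI)
  moreover have "x \<in> cylinder (map x [0..<l])" by (simp add: mem_cylinder_iff)
  ultimately show "x \<in> ?U" by blast
next
  fix x assume "x \<in> ?U"
  then obtain w i where w: "p i = Suc (word_code w)" "map x [0..<length w] = w"
    unfolding mem_cylinder_iff[symmetric] by (metis (mono_tags, lifting) UN_E imageE mem_Collect_eq)
  \<comment> \<open>Long enough both to contain \<open>w\<close> and to pass the stage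
    \<open>i\<close> at which it is enumerated.\<close>
  define n where "n = max i (length w)"
  have "take (length w) (map x [0..<n]) = w" using w(2) by (simp add: n_def take_map)
  then have "bad ?s (map x [0..<n])"
    unfolding bad_def using w(1) by (intro exI[of _ i] conjI exI[of _ "length w"]) (auto simp: n_def)
  then show "x \<in> bad_set ?s" unfolding bad_set_def by blast
qed

lemma recf_bpair:
  assumes "recf a" "recf b" "recf f"
  shows "recf (\<lambda>s x. bpair (a s) (b s) (f s x))"
  unfolding bpair_def
  by (intro recf_intros assms recf_comp[OF assms(1)] recf_comp[OF assms(2)])

section \<open>A universal Martin-Loef test\<close>

text \<open>
  Stage \<open>t\<close> of the component \<open>e + 2\<close> of the test with index \<open>e\<close> covers the words below. A stage is
  used only as long as it is light, that is, has measure at most \<open>2 ^ - (e + 2)\<close>; this leaves true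
  tests unchanged, and the light stages of all \<open>e\<close> together have measure at most \<open>1 / 2\<close>.
\<close>

definition cover :: "baire \<Rightarrow> nat \<Rightarrow> nat \<Rightarrow> bool list \<Rightarrow> bool" where
  "cover s e t w \<longleftrightarrow>
     (\<exists>j<t. result s e (pr (Suc (Suc e)) j) t \<noteq> 0 \<and> take (length (word_of j)) w = word_of j)"

definition light :: "baire \<Rightarrow> nat \<Rightarrow> nat \<Rightarrow> bool" where
  "light s e t \<longleftrightarrow> card {w. length w = t \<and> cover s e t w} * 2 ^ Suc (Suc e) \<le> 2 ^ t"

text \<open>Bounding both indices by the length makes the condition decidable; along an infinite
  path all pairs of indices are reached.\<close>

definition kept :: "baire \<Rightarrow> bool list \<Rightarrow> bool" where
  "kept s w \<longleftrightarrow> (\<forall>e<Suc (length w). \<forall>t<Suc (length w). light s e t \<longrightarrow> \<not> cover s e t w)"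

definition cover_set :: "baire \<Rightarrow> nat \<Rightarrow> nat \<Rightarrow> cantor set" where
  "cover_set s e t = {x. cover s e t (map x [0..<t])}"

definition light_set :: "baire \<Rightarrow> nat \<Rightarrow> cantor set" where
  "light_set s e = (\<Union>t\<in>{t. light s e t}. cover_set s e t)"

text \<open>Stage \<open>t\<close> uses only words with codes below \<open>t\<close>. Their lengths
  are below \<open>t\<close> too, so \<open>t\<close> bits of \<open>x\<close> suffice.\<close>

lemma cover_prefix_iff:
  assumes "t \<le> n"
  shows "cover s e t (map x [0..<n]) \<longleftrightarrow>
    (\<exists>j<t. result s e (pr (Suc (Suc e)) j) t \<noteq> 0 \<and> x \<in> cylinder (word_of j))"
proof -
  have take: "take (length (word_of j)) (map x [0..<n]) = map x [0..<length (word_of j)]" if "j < t" for j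
    using that assms length_le_word_code[of "word_of j"] by (simp add: take_map)
  show ?thesis unfolding cover_def mem_cylinder_iff
    by (intro ex_cong1 conj_cong refl) (simp add: take)
qed

lemma mem_cover_set_iff:
  "x \<in> cover_set s e t \<longleftrightarrow>
    (\<exists>j<t. result s e (pr (Suc (Suc e)) j) t \<noteq> 0 \<and> x \<in> cylinder (word_of j))"
  unfolding cover_set_def mem_Collect_eq by (rule cover_prefix_iff) simp

lemma cover_set_mono:
  assumes "t \<le> t'" shows "cover_set s e t \<subseteq> cover_set s e t'"
proof
  fix x assume "x \<in> cover_set s e t"
  then obtain j y where j: "j < t" "x \<in> cylinder (word_of j)" "result s e (pr (Suc (Suc e)) j) t = Suc y"
    unfolding mem_cover_set_iff using not0_implies_Suc by blast
  from result_mono[OF j(3) assms] j(1,2) assms show "x \<in> cover_set s e t'"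
    unfolding mem_cover_set_iff by (intro exI[of _ j]) auto
qed

lemma sets_cover_set: "cover_set s e t \<in> sets \<mu>"
  unfolding cover_set_def by (rule sets_Collect_prefix)

lemma light_iff: "light s e t \<longleftrightarrow> measure \<mu> (cover_set s e t) \<le> (1 / 2) ^ Suc (Suc e)"
proof -
  have "light s e t \<longleftrightarrow> real (card {w. length w = t \<and> cover s e t w} * 2 ^ Suc (Suc e)) \<le> real (2 ^ t)"
    unfolding light_def by (rule of_nat_le_iff[symmetric])
  also have "\<dots> \<longleftrightarrow> real (card {w. length w = t \<and> cover s e t w}) / 2 ^ t \<le> (1 / 2) ^ Suc (Suc e)"
    by (simp add: field_simps power_one_over)
  finally show ?thesis unfolding cover_set_def measure_Collect_prefix .
qed

lemma sets_light_set: "light_set s e \<in> sets \<mu>"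
  unfolding light_set_def by (rule sets.countable_UN'') (simp_all add: sets_cover_set)

text \<open>Stages increase, so the light stages up to \<open>n\<close> all lie in the last light
  one among them, which satisfies the bound; continuity from below does the rest.\<close>

lemma measure_light_set: "measure \<mu> (light_set s e) \<le> (1 / 2) ^ Suc (Suc e)"
proof -
  define B where "B n = (\<Union>t\<in>{t. t \<le> n \<and> light s e t}. cover_set s e t)" for n
  have B_sets: "B n \<in> sets \<mu>" for n
    unfolding B_def by (rule sets.countable_UN'') (simp_all add: sets_cover_set)
  have B: "measure \<mu> (B n) \<le> (1 / 2) ^ Suc (Suc e)" for n
  proof (cases "{t. t \<le> n \<and> light s e t} = {}")
    case True
    then have "B n = {}" unfolding B_def True by simp
    then show ?thesis by simp
  next
    case False
    define m where "m = Max {t. t \<le> n \<and> light s e t}"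
    have fin: "finite {t. t \<le> n \<and> light s e t}" by simp
    have m: "light s e m" using Max_in[OF fin False] unfolding m_def by simp
    have "B n \<subseteq> cover_set s e m"
      unfolding B_def using cover_set_mono Max_ge[OF fin] m_def by blast
    then have "measure \<mu> (B n) \<le> measure \<mu> (cover_set s e m)"
      by (rule mu.finite_measure_mono[OF _ sets_cover_set])
    then show ?thesis using m light_iff by force
  qed
  have "measure \<mu> (\<Union>n. B n) \<le> (1 / 2) ^ Suc (Suc e)"
  proof (rule LIMSEQ_le_const2)
    show "(\<lambda>n. measure \<mu> (B n)) \<longlonglongrightarrow> measure \<mu> (\<Union>n. B n)"
    proof (rule mu.finite_Lim_measure_incseq)
      show "incseq B" unfolding incseq_def B_def by (intro allI impI UN_mono) auto
    qed (use B_sets in blast)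
    show "\<exists>N. \<forall>n\<ge>N. measure \<mu> (B n) \<le> (1 / 2) ^ Suc (Suc e)" using B by blast
  qed
  moreover have "(\<Union>n. B n) = light_set s e"
    unfolding B_def light_set_def by auto
  ultimately show ?thesis by simp
qed

lemma paths_kept: "paths {w. kept s w} = - (\<Union>e. light_set s e)"
proof (rule set_eqI)
  fix x
  have "x \<in> paths {w. kept s w} \<longleftrightarrow>
      (\<forall>n. \<forall>e\<le>n. \<forall>t\<le>n. light s e t \<longrightarrow> \<not> cover s e t (map x [0..<n]))"
    by (simp add: paths_def kept_def less_Suc_eq_le)
  also have "\<dots> \<longleftrightarrow> (\<forall>n. \<forall>e\<le>n. \<forall>t\<le>n. light s e t \<longrightarrow> x \<notin> cover_set s e t)"
    unfolding mem_cover_set_iff by (simp add: cover_prefix_iff)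
  also have "\<dots> \<longleftrightarrow> (\<forall>e t. light s e t \<longrightarrow> x \<notin> cover_set s e t)"
    by (meson max.cobounded1 max.cobounded2)
  finally show "x \<in> paths {w. kept s w} \<longleftrightarrow> x \<in> - (\<Union>e. light_set s e)"
    unfolding light_set_def by blast
qed

lemma measure_paths_kept: "measure \<mu> (paths {w. kept s w}) > 0"
proof -
  have sums: "(\<lambda>e. (1 / 2 :: real) ^ Suc (Suc e)) sums (1 / 2)"
    using sums_mult[OF geometric_sums[of "1 / 2 :: real"], of "1 / 4"] by simp
  have summable: "summable (\<lambda>e. measure \<mu> (light_set s e))"
    by (rule summable_comparison_test'[OF sums_summable[OF sums]]) (use measure_light_set in simp)
  have "measure \<mu> (\<Union>e. light_set s e) \<le> (\<Sum>e. measure \<mu> (light_set s e))"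
    by (rule mu.finite_measure_subadditive_countably[OF _ summable]) (auto simp: sets_light_set)
  also have "\<dots> \<le> (\<Sum>e. (1 / 2) ^ Suc (Suc e))"
    by (rule suminf_le[OF measure_light_set summable sums_summable[OF sums]])
  also have "\<dots> = 1 / 2" using sums by (rule sums_unique[symmetric])
  finally have "measure \<mu> (\<Union>e. light_set s e) \<le> 1 / 2" .
  moreover have "(\<Union>e. light_set s e) \<in> sets \<mu>" by (intro sets.countable_UN) (auto simp: sets_light_set)
  ultimately show ?thesis
    unfolding paths_kept using mu.prob_compl[of "\<Union>e. light_set s e"] by (simp add: Compl_eq_Diff_UNIV)
qed

lemma is_tree_kept: "is_tree {w. kept s w}"
proof -
  have "cover s e t (v @ w)" if "cover s e t v" for e t v w
  proof -
    from that obtain j where j: "j < t" "result s e (pr (Suc (Suc e)) j) t \<noteq> 0" "take (length (word_of j)) v = word_of j"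
      unfolding cover_def by blast
    from j(3) have "length (word_of j) \<le> length v" by (metis length_take min.cobounded1)
    with j(3) have "take (length (word_of j)) (v @ w) = word_of j" by simp
    with j show ?thesis unfolding cover_def by blast
  qed
  then have "kept s v" if "kept s (v @ w)" for v w
    using that unfolding kept_def by (metis length_append less_Suc_eq_le trans_le_add1)
  then show ?thesis unfolding is_tree_def by blast
qed

lemma infinite_tree: "x \<in> paths T \<Longrightarrow> infinite T"
proof
  assume x: "x \<in> paths T" and fin: "finite T"
  have "inj (\<lambda>n. map x [0..<n])" by (rule injI) (metis length_map length_upt minus_nat.diff_0)
  moreover have "range (\<lambda>n. map x [0..<n]) \<subseteq> T" using x by (auto simp: paths_def)
  ultimately show False using fin by (metis finite_imageD finite_subset infinite_UNIV_nat)
qed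

text \<open>For the index \<open>e\<close> of a true test every stage is light, being part of
  component \<open>e + 2\<close>. Hence that whole component is removed from the paths, and one
  component suffices to leave the intersection.\<close>

lemma ml_random_paths_kept:
  assumes x: "x \<in> paths {w. kept s w}" and s: "s = (\<lambda>i. of_bool (b i))"
  shows "ml_random b x"
  unfolding ml_random_def
proof (intro allI impI notI)
  fix U assume "ml_test b U" and xU: "x \<in> (\<Inter>n. U n)"
  then obtain c where U: "\<And>n. U n = (\<Union>w\<in>{w. eval s c (pr n (word_code w)) \<noteq> None}. cylinder w)"
    and meas: "\<And>n. measure \<mu> (U n) \<le> (1 / 2) ^ n"
    unfolding ml_test_def uniformly_ce_open_def s by blast
  define e where "e = prog_code c"
  have "x \<in> U (Suc (Suc e))" using xU by blast
  then obtain w y where w: "x \<in> cylinder w" "eval s c (pr (Suc (Suc e)) (word_code w)) = Some y"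
    unfolding U by blast
  then obtain t0 where "result s e (pr (Suc (Suc e)) (word_code w)) t0 = Suc y"
    using result_complete unfolding e_def by blast
  \<comment> \<open>A stage considers only word codes below it, so it must exceed the code of
    \<open>w\<close> in addition to the running time.\<close>
  then have "result s e (pr (Suc (Suc e)) (word_code w)) (max t0 (Suc (word_code w))) = Suc y"
    by (rule result_mono) simp
  then have "x \<in> cover_set s e (max t0 (Suc (word_code w)))"
    unfolding mem_cover_set_iff using w(1) by (intro exI[of _ "word_code w"]) auto
  moreover have "light s e t" for t
  proof -
    have "cover_set s e t \<subseteq> U (Suc (Suc e))"
    proof
      fix z assume "z \<in> cover_set s e t"
      then obtain j y where "result s e (pr (Suc (Suc e)) j) t = Suc y" "z \<in> cylinder (word_of j)"
        unfolding mem_cover_set_iff using not0_implies_Suc by blast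
      then have "eval s c (pr (Suc (Suc e)) (word_code (word_of j))) \<noteq> None" "z \<in> cylinder (word_of j)"
        using result_sound unfolding e_def by fastforce+
      then show "z \<in> U (Suc (Suc e))" unfolding U by blast
    qed
    moreover have "U (Suc (Suc e)) \<in> sets \<mu>" unfolding U by (rule sets_UN_cylinder)
    ultimately show ?thesis unfolding light_iff
      by (rule order_trans[OF mu.finite_measure_mono meas])
  qed
  ultimately have "x \<in> light_set s e" unfolding light_set_def by blast
  with x show False unfolding paths_kept by blast
qed

text \<open>A realizer owes answers only on the domain, so \<open>MLR\<close> can be queried at
  \<open>b\<close> only once a value is known to exist.\<close>

lemma ex_ml_random: "\<exists>q. ml_random b q"
proof -
  have "paths {w. kept (\<lambda>i. of_bool (b i)) w} \<noteq> {}"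
    using measure_paths_kept by (metis measure_empty less_irrefl)
  then show ?thesis using ml_random_paths_kept by blast
qed

lemma paths_kept_mem_mdom: "{w. kept s w} \<in> mdom (fn WWKL)"
proof -
  have "paths {w. kept s w} \<noteq> {}" using measure_paths_kept by (metis measure_empty less_irrefl)
  then have "infinite {w. kept s w}" using infinite_tree by blast
  then show ?thesis
    using \<open>paths {w. kept s w} \<noteq> {}\<close> measure_paths_kept is_tree_kept by (simp add: WWKL_def mdom_def)
qed

lemma recf_cover:
  assumes "recf f" "recf g" "recf h"
  shows "recf (\<lambda>s x. of_bool (cover s (f s x) (g s x) (word_of (h s x))))"
proof -
  have eq: "cover s e t (word_of n) \<longleftrightarrow> (\<exists>j<t. \<not> result s e (pr (Suc (Suc e)) j) t = 0 \<and>
      word_code (take (length (word_of j)) (word_of n)) = j)" for s e t n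
    unfolding cover_def by (metis word_code_word_of word_of_word_code)
  have "recf (\<lambda>s x. s (p2 x))" by (intro recf_intros)
  note result = recf_result[where orc="\<lambda>s _. s", OF this]
  have "recf (\<lambda>s z. of_bool (cover s (p1 z) (p1 (p2 z)) (word_of (p2 (p2 z)))))"
    unfolding eq by (intro recf_intros result[where f="\<lambda>_ _. 0"])
  from recf_comp3[where h="\<lambda>s e t n. of_bool (cover s e t (word_of n))", OF this assms] show ?thesis .
qed

text \<open>Words of length \<open>t\<close> have codes below \<open>2 ^ Suc t\<close>, so counting
  them is a bounded sum.\<close>

lemma recf_light:
  assumes "recf f" "recf g"
  shows "recf (\<lambda>s x. of_bool (light s (f s x) (g s x)))"
proof -
  have "card {w. length w = t \<and> cover s e t w} =
      (\<Sum>j<2 ^ Suc t. of_bool (length (word_of j) = t \<and> cover s e t (word_of j)))" for s e t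
  proof -
    have "(\<Sum>j<2 ^ Suc t. of_bool (length (word_of j) = t \<and> cover s e t (word_of j))) =
        card ({..<2 ^ Suc t} \<inter> {j. length (word_of j) = t \<and> cover s e t (word_of j)})"
      by (simp add: of_bool_def sum.If_cases del: power_Suc)
    also have "{..<2 ^ Suc t} \<inter> {j. length (word_of j) = t \<and> cover s e t (word_of j)} =
        word_code ` {w. length w = t \<and> cover s e t w}"
    proof (intro set_eqI iffI)
      fix j assume "j \<in> {..<2 ^ Suc t} \<inter> {j. length (word_of j) = t \<and> cover s e t (word_of j)}"
      then show "j \<in> word_code ` {w. length w = t \<and> cover s e t w}"
        by (intro image_eqI[of _ _ "word_of j"]) auto
    qed (use word_code_less in auto)
    also have "card \<dots> = card {w. length w = t \<and> cover s e t w}"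
      by (rule card_image) (rule inj_on_subset[OF inj_word_code], simp)
    finally show ?thesis by simp
  qed
  then have eq: "light s e t \<longleftrightarrow>
      (\<Sum>j<2 ^ Suc t. of_bool (length (word_of j) = t \<and> cover s e t (word_of j))) * 2 ^ Suc (Suc e) \<le> (2 ^ t :: nat)"
    for s e t
    unfolding light_def by simp
  have "recf (\<lambda>s z. of_bool (light s (p1 z) (p2 z)))"
    unfolding eq by (intro recf_intros recf_cover)
  from recf_comp2[where h="\<lambda>s e t. of_bool (light s e t)", OF this assms] show ?thesis .
qed

lemma recf_kept: "recf (\<lambda>s n. of_bool (kept s (word_of n)))"
  unfolding kept_def by (intro recf_intros recf_light recf_cover)

section \<open>From random sequences to closed sets of positive measure\<close>

lemma implication_PC_le_MLR: "(C_nat \<rightarrow>\<^sub>W PC_cantor) \<le>\<^sub>W MLR"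
proof -
  obtain k where k: "\<And>y n. Phi_mv nat_rep cantor_rep (\<lambda>i. if i = 0 then k else of_bool (y (i - 1))) n = {drop_seq n y}"
    using shift_function by blast
  define H where "H p = (\<lambda>i. of_bool (p (p1 i) = p2 i) :: nat)" for p :: baire
  define h where "h s = (\<lambda>i. if i = 0 then k else bsnd s (i - 1))" for s
  \<comment> \<open>The place \<open>z\<close> codes a shift \<open>n\<close>, an index
    \<open>i\<close> and a length \<open>l\<close>. The shift is ruled out when \<open>p i\<close>
    lists the prefix of length \<open>l\<close> of the shifted sequence, which happens for some
    \<open>i\<close> and \<open>l\<close> exactly if that sequence is outside
    \<open>A\<close>.\<close>
  define a where "a s = (\<lambda>z. if bfst s (p1 (p2 z)) =
      Suc (word_code (map (\<lambda>j. bsnd s (p1 z + j) = 1) [0..<p2 (p2 z)])) then Suc (p1 z) else 0)" for s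
  have "recf h" unfolding h_def by (intro recf_intros recf_bsnd)
  moreover have "recf a" unfolding a_def by (intro recf_intros recf_bfst recf_bsnd recf_word_code)
  ultimately have K: "computable (\<lambda>s. Some (bpair (h s) (a s)))"
    by (intro computable_total recf_bpair recf_intros)
  have "computable (\<lambda>s. Some (H s))"
    unfolding H_def by (intro computable_total recf_intros)
  moreover have "realizes (\<lambda>p. Option.bind (Option.bind (Some (H p)) G) (\<lambda>r. Some (bpair (h (bpair p r)) (a (bpair p r)))))
      (C_nat \<rightarrow>\<^sub>W PC_cantor)" if G: "realizes G MLR" for G
    unfolding realizes_def
  proof (intro allI impI)
    fix p A assume "src (C_nat \<rightarrow>\<^sub>W PC_cantor) p = Some A \<and> A \<in> mdom (fn (C_nat \<rightarrow>\<^sub>W PC_cantor))"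
    then have p: "closed_cantor_rep p = Some A" and A: "A \<in> mdom (fn PC_cantor)"
      using mdom_implicationD by auto
    define b where "b = (\<lambda>i. p (p1 i) = p2 i)"
    have Hp: "H p = (\<lambda>i. of_bool (b i))" by (simp add: H_def b_def)
    have U: "bad_set (H p) = - A"
      using p unfolding H_def bad_set_graph by (auto simp: closed_cantor_rep_def)
    have fnA: "fn PC_cantor A = A" and pos: "measure \<mu> A > 0"
      using A by (auto simp: mdom_def fn_PC split: if_splits)
    have "bad_set (H p) \<in> sets \<mu>" unfolding bad_set_def Collect_Ex_prefix_eq by (rule sets_UN_cylinder)
    then have "measure \<mu> (bad_set (H p)) < 1"
      using mu.prob_compl[of "bad_set (H p)"] pos U by (simp add: Compl_eq_Diff_UNIV[symmetric])
    have "cantor_rep (H p) = Some b" by (simp add: cantor_rep_eq_Some_iff Hp)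
    moreover have "b \<in> mdom (fn MLR)" using ex_ml_random[of b] by (simp add: mdom_def)
    ultimately obtain r q where r: "G (H p) = Some r" "cantor_rep r = Some q" "ml_random b q"
      using realizesD[OF G, of "H p" b] by auto
    have rq: "r i = of_bool (q i)" for i
      using r(2) by (simp add: cantor_rep_eq_Some_iff)
    obtain n where n: "drop_seq n q \<in> A"
      using ml_random_tail[OF r(3) Hp] \<open>measure \<mu> (bad_set (H p)) < 1\<close> U by auto
    define s where "s = bpair p r"
    define B where "B = {n. drop_seq n q \<in> A}"
    define F where "F = Phi_mv nat_rep cantor_rep (h s)"
    have F: "F n = {drop_seq n q}" for n
      unfolding F_def h_def s_def bsnd_bpair rq by (rule k)
    have rq1: "(\<lambda>j. r (m + j) = 1) = drop_seq m q" for m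
      by (auto simp: rq drop_seq_def of_bool_def)
    have a_eq: "a s z = (if p (p1 (p2 z)) = Suc (word_code (map (drop_seq (p1 z) q) [0..<p2 (p2 z)]))
        then Suc (p1 z) else 0)" for z
      by (simp only: a_def s_def bfst_bpair bsnd_bpair rq1)
    have "Suc n \<in> range (a s) \<longleftrightarrow> n \<notin> B" for n
    proof -
      have "Suc n \<in> range (a s) \<longleftrightarrow> (\<exists>i l. p i = Suc (word_code (map (drop_seq n q) [0..<l])))"
      proof
        assume "Suc n \<in> range (a s)"
        then obtain z where "a s z = Suc n" by (metis imageE)
        then show "\<exists>i l. p i = Suc (word_code (map (drop_seq n q) [0..<l]))"
          by (auto simp: a_eq split: if_splits)
      next
        assume "\<exists>i l. p i = Suc (word_code (map (drop_seq n q) [0..<l]))"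
        then obtain i l where "p i = Suc (word_code (map (drop_seq n q) [0..<l]))" by blast
        then have "a s (pr n (pr i l)) = Suc n"
          by (simp add: a_eq)
        then show "Suc n \<in> range (a s)" by (metis rangeI)
      qed
      also have "\<dots> \<longleftrightarrow> (\<exists>w. Suc (word_code w) \<in> range p \<and> drop_seq n q \<in> cylinder w)"
        unfolding mem_cylinder_iff image_iff
        by (metis UNIV_I length_map length_upt minus_nat.diff_0)
      also have "\<dots> \<longleftrightarrow> n \<notin> B"
        using p by (auto simp: B_def closed_cantor_rep_def)
      finally show ?thesis .
    qed
    then have "closed_nat_rep (a s) = Some B" by (auto simp: closed_nat_rep_def)
    then have "tgt (C_nat \<rightarrow>\<^sub>W PC_cantor) (bpair (h s) (a s)) = Some (F, B)"
      by (simp add: prod_rep_def mvf_rep_def F_def)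
    moreover have "(F, B) \<in> fn (C_nat \<rightarrow>\<^sub>W PC_cantor) A"
      unfolding mem_C_nat_implication_iff[OF PC_simps(2)] fnA
      using A n rangeI[of "Phi_mv nat_rep cantor_rep" "h s", folded F_def] by (auto simp: F mdom_def B_def)
    ultimately show "\<exists>r y. Option.bind (Option.bind (Some (H p)) G)
          (\<lambda>r. Some (bpair (h (bpair p r)) (a (bpair p r)))) = Some r \<and>
        tgt (C_nat \<rightarrow>\<^sub>W PC_cantor) r = Some y \<and> y \<in> fn (C_nat \<rightarrow>\<^sub>W PC_cantor) A"
      by (intro exI[of _ "bpair (h s) (a s)"] exI[of _ "(F, B)"]) (simp add: r s_def)
  qed
  ultimately show ?thesis unfolding weihrauch_le_def using K by blast
qed

section \<open>Randomness is invariant under finite changes\<close>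

text \<open>The letter is spelled with implications and negations because these are the connectives
  with closure rules.\<close>

definition flip_word :: "nat \<Rightarrow> bool list \<Rightarrow> bool list" where
  "flip_word k w = map (\<lambda>i. (i = k \<longrightarrow> \<not> w ! i) \<and> (\<not> i = k \<longrightarrow> w ! i)) [0..<length w]"

lemma flip_mem_cylinder_iff: "flip k x \<in> cylinder w \<longleftrightarrow> x \<in> cylinder (flip_word k w)"
  by (auto simp: cylinder_def flip_def flip_word_def)

lemma flip_word_flip_word: "flip_word k (flip_word k w) = w"
  by (rule nth_equalityI) (auto simp: flip_word_def)

lemma recf_flip_word: "recf f \<Longrightarrow> recf (\<lambda>s x. word_code (flip_word k (word_of (f s x))))"
proof (rule recf_comp[where g="\<lambda>s x. word_code (flip_word k (word_of x))"])
  have "flip_word k w = map (\<lambda>i. (i = k \<longrightarrow> \<not> (i < length w \<and> w ! i)) \<and> (\<not> i = k \<longrightarrow> i < length w \<and> w ! i)) [0..<length w]" for w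
    by (auto simp: flip_word_def)
  then show "recf (\<lambda>s x. word_code (flip_word k (word_of x)))"
    by (simp only:) (intro recf_word_code recf_intros)
qed

text \<open>The preimage of a test under a flip is again a test: flips preserve the measure and
  permute the cylinders computably.\<close>

lemma ml_random_flip:
  assumes q: "ml_random b q" shows "ml_random b (flip k q)"
  unfolding ml_random_def
proof (intro allI impI notI)
  fix U assume "ml_test b U" and qU: "flip k q \<in> (\<Inter>n. U n)"
  then obtain c where U: "\<And>n. U n = (\<Union>w\<in>{w. eval (\<lambda>i. of_bool (b i)) c (pr n (word_code w)) \<noteq> None}. cylinder w)"
    and meas: "\<And>n. measure \<mu> (U n) \<le> (1 / 2) ^ n"
    unfolding ml_test_def uniformly_ce_open_def by blast
  have "recf (\<lambda>s z. pr (p1 z) (word_code (flip_word k (word_of (p2 z)))))"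
    by (intro recf_intros recf_flip_word)
  then obtain d where d: "\<And>s z. eval s d z = Some (pr (p1 z) (word_code (flip_word k (word_of (p2 z)))))"
    unfolding recf_def by blast
  have "ml_test b (\<lambda>n. {x. flip k x \<in> U n})"
    unfolding ml_test_def uniformly_ce_open_def
  proof (intro conjI exI[of _ "Comp c d"] allI)
    fix n
    have "U n \<in> sets \<mu>" unfolding U by (rule sets_UN_cylinder)
    then show "measure \<mu> {x. flip k x \<in> U n} \<le> (1 / 2) ^ n" using meas by (simp add: measure_flip)
    let ?E = "\<lambda>w. eval (\<lambda>i. of_bool (b i)) c (pr n (word_code w)) \<noteq> None"
    have "eval (\<lambda>i. of_bool (b i)) (Comp c d) (pr n (word_code w)) \<noteq> None \<longleftrightarrow> ?E (flip_word k w)" for w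
      by (simp add: d)
    moreover have "{x. flip k x \<in> U n} = (\<Union>w\<in>{w. ?E (flip_word k w)}. cylinder w)"
    proof (intro set_eqI iffI)
      fix x assume "x \<in> {x. flip k x \<in> U n}"
      then obtain w where "?E w" "x \<in> cylinder (flip_word k w)"
        unfolding U using flip_mem_cylinder_iff by auto
      then show "x \<in> (\<Union>w\<in>{w. ?E (flip_word k w)}. cylinder w)"
        by (intro UN_I[of "flip_word k w"]) (simp_all add: flip_word_flip_word)
    next
      fix x assume "x \<in> (\<Union>w\<in>{w. ?E (flip_word k w)}. cylinder w)"
      then obtain w where "?E (flip_word k w)" "flip k x \<in> cylinder (flip_word k w)"
        using flip_mem_cylinder_iff flip_word_flip_word by auto
      then show "x \<in> {x. flip k x \<in> U n}" unfolding U by blast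
    qed
    ultimately show "{x. flip k x \<in> U n} =
        (\<Union>w\<in>{w. eval (\<lambda>i. of_bool (b i)) (Comp c d) (pr n (word_code w)) \<noteq> None}. cylinder w)"
      by simp
  qed
  then show False using q qU unfolding ml_random_def by blast
qed

lemma ml_random_cong_finite:
  assumes "ml_random b q" "\<And>i. i \<ge> N \<Longrightarrow> q' i = q i"
  shows "ml_random b q'"
  using assms(2)
proof (induction N arbitrary: q')
  case 0
  then have "q' = q" by auto
  then show ?case using assms(1) by simp
next
  case (Suc N)
  have "ml_random b (q'(N := q N))"
  proof (rule Suc.IH)
    show "(q'(N := q N)) i = q i" if "i \<ge> N" for i
      using that Suc.prems[of i] by (cases "i = N") auto
  qed
  moreover have "q' = q'(N := q N) \<or> q' = flip N (q'(N := q N))"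
    by (auto simp: flip_def fun_eq_iff)
  ultimately show ?case using ml_random_flip by metis
qed

section \<open>From paths to random sequences\<close>

text \<open>The guess at stage \<open>t\<close>: the least number not excluded by the first
  \<open>t\<close> entries of the name, found by the sum of \<open>sum_Least\<close>.\<close>

definition least_open :: "baire \<Rightarrow> nat \<Rightarrow> nat" where
  "least_open a t = (\<Sum>n<t. of_bool (\<forall>j<Suc n. \<exists>i<t. a i = Suc j))"

lemma least_open_eventually:
  assumes "closed_nat_rep a = Some A" "A \<noteq> {}"
  obtains N m where "m \<in> A" "\<And>t. t \<ge> N \<Longrightarrow> least_open a t = m"
proof -
  have A: "n \<in> A \<longleftrightarrow> (\<forall>i. a i \<noteq> Suc n)" for n
    using assms(1) unfolding closed_nat_rep_def by (metis ComplD ComplI imageE mem_Collect_eq option.inject rangeI)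
  define m where "m = (LEAST n. n \<in> A)"
  have m: "m \<in> A" unfolding m_def using assms(2) by (metis LeastI ex_in_conv)
  have "\<exists>i. a i = Suc j" if "j < m" for j
    using that not_less_Least[of j "\<lambda>n. n \<in> A"] unfolding m_def A by blast
  then obtain f where f: "\<And>j. j < m \<Longrightarrow> a (f j) = Suc j" by metis
  \<comment> \<open>By this stage every number below \<open>m\<close> has been excluded, and the
    summand \<open>m\<close> lets the sum in \<open>least_open\<close> reach up to
    \<open>m\<close>.\<close>
  define N where "N = Suc (m + (\<Sum>j<m. f j))"
  have "least_open a t = m" if t: "t \<ge> N" for t
  proof -
    have "f j < t" if "j < m" for j
      using member_le_sum[of j "{..<m}" f] that t by (simp add: N_def)
    then have "(LEAST n. \<not> (\<exists>i<t. a i = Suc n)) = m"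
      using f m[unfolded A] by (intro Least_equality) (auto simp: not_less[symmetric])
    moreover have "\<not> (\<exists>i<t. a i = Suc m)" "m \<le> t" using m[unfolded A] t by (auto simp: N_def)
    ultimately show ?thesis
      unfolding least_open_def using sum_Least[of "\<lambda>n. \<not> (\<exists>i<t. a i = Suc n)" m t] by simp
  qed
  with m show ?thesis by (rule that)
qed

lemma MLR_le_implication_WWKL: "MLR \<le>\<^sub>W (C_nat \<rightarrow>\<^sub>W WWKL)"
proof -
  define H where "H s = (\<lambda>n. of_bool (kept s (word_of n)) :: nat)" for s
  have H: "computable (\<lambda>s. Some (H s))"
    unfolding H_def by (intro computable_total recf_kept)
  \<comment> \<open>The program that names the answer is run on the current guess for the least member of the
    answer set. The guess converges, so all but finitely many bits come from a correct run.\<close>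
  define orc where "orc s t = bpair (bfst (bsnd s)) (\<lambda>_. least_open (bsnd (bsnd s)) t)" for s t
  define out where "out s i t = result (orc s t) (bfst (bsnd s) 0) i t" for s i t
  have first: "recf (\<lambda>s x. bfst (bsnd s) (f s x))" if "recf f" for f
    unfolding bfst_def by (intro recf_intros recf_bsnd that)
  have second: "recf (\<lambda>s x. bsnd (bsnd s) (f s x))" if "recf f" for f
    unfolding bsnd_def[of "bsnd _"] by (intro recf_intros recf_bsnd that)
  have "recf (\<lambda>s x. least_open (bsnd (bsnd s)) x)"
    unfolding least_open_def by (intro recf_intros second)
  then have least_open: "recf (\<lambda>s x. least_open (bsnd (bsnd s)) (f s x))" if "recf f" for f
    using that by (rule recf_comp)
  have "recf (\<lambda>s z. orc s (p1 z) (p2 z))"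
    unfolding orc_def bpair_def by (intro recf_intros first least_open)
  \<comment> \<open>Bit \<open>i\<close> is sought at stages \<open>i + k\<close> only, so every bit
    from \<open>N\<close> on is computed with the final guess.\<close>
  then have recf_out: "recf (\<lambda>s z. out s (p1 z) (p1 z + p2 z))"
    unfolding out_def by (intro recf_result recf_intros first)
  have "recf (\<lambda>s z. of_bool (\<not> out s (p1 z) (p1 z + p2 z) = 0))"
    by (intro recf_intros recf_out)
  then obtain c where c: "\<And>s i k. \<not> out s i (i + k) = 0 \<Longrightarrow>
      eval s c i = Some (LEAST k. \<not> out s i (i + k) = 0)"
    by (rule recf_minimize[where P="\<lambda>s i k. \<not> out s i (i + k) = 0"]) blast
  \<comment> \<open>Results are successors of output values, so 2 stands for bit 1. All other
    results give bit 0, which keeps the output binary even when a wrong guess produces another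
    number.\<close>
  have "recf (\<lambda>s z. of_bool (out s (p1 z) (p1 z + p2 z) = 2))"
    by (intro recf_intros recf_out)
  then obtain d where d: "\<And>s z. eval s d z = Some (of_bool (out s (p1 z) (p1 z + p2 z) = 2))"
    unfolding recf_def by blast
  obtain e where e: "\<And>s x. eval s e x = Some x"
    using recf_id unfolding recf_def by blast
  define K where "K = compute (Comp d (Tup e c))"
  have K: "computable K" unfolding K_def by (rule computable_compute)
  have "realizes (\<lambda>p. Option.bind (Option.bind (Some (H p)) G) (\<lambda>r. K (bpair p r))) MLR"
    if G: "realizes G (C_nat \<rightarrow>\<^sub>W WWKL)" for G
    unfolding realizes_def
  proof (intro allI impI)
    fix p b assume "src MLR p = Some b \<and> b \<in> mdom (fn MLR)"
    then have p: "p = (\<lambda>i. of_bool (b i))"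
      by (simp add: cantor_rep_eq_Some_iff)
    let ?T = "{w. kept p w}"
    have "tree_rep (H p) = Some ?T"
      using is_tree_kept[of p] by (auto simp: tree_rep_def H_def)
    moreover have "?T \<in> mdom (fn (C_nat \<rightarrow>\<^sub>W WWKL))"
      by (rule mem_mdom_C_nat_implication[OF WWKL_simps(2) paths_kept_mem_mdom])
    ultimately obtain r F A where r: "G (H p) = Some r" "tgt (C_nat \<rightarrow>\<^sub>W WWKL) r = Some (F, A)"
      "(F, A) \<in> fn (C_nat \<rightarrow>\<^sub>W WWKL) ?T"
      using realizesD[OF G, of "H p" ?T] by auto
    define h where "h = bfst r"
    define a where "a = bsnd r"
    define s where "s = bpair p r"
    have F: "F = Phi_mv nat_rep cantor_rep h" and A: "closed_nat_rep a = Some A"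
      using r(2) by (auto simp: prod_rep_def mvf_rep_def h_def a_def bind_eq_Some_conv)
    have ne: "A \<noteq> {}" and dom: "A \<subseteq> mdom F" and sub: "\<Union> (F ` A) \<subseteq> paths ?T"
      using r(3) fn_WWKL_eq_PC(1)[OF paths_kept_mem_mdom]
      unfolding mem_C_nat_implication_iff[OF WWKL_simps(2)] by auto
    obtain N m where m: "m \<in> A" and N: "\<And>t. t \<ge> N \<Longrightarrow> least_open a t = m"
      using least_open_eventually[OF A ne] by metis
    have "F m \<noteq> {}" using m dom by (auto simp: mdom_def)
    then obtain r' z where r': "Phi h (\<lambda>_. m) = Some r'" and z: "cantor_rep r' = Some z"
      unfolding F using mem_Phi_mv_iff by (metis ex_in_conv)
    have "z \<in> F m"
      unfolding F mem_Phi_mv_iff using \<open>F m \<noteq> {}\<close> r' z unfolding F by (metis ex_in_conv mem_Phi_mv_iff)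
    then have "ml_random b z" using ml_random_paths_kept[OF _ p] sub m by blast
    let ?o = "bpair h (\<lambda>_. m)"
    from r' obtain g where g: "h 0 = prog_code g" and eval: "\<And>i. eval ?o g i = Some (r' i)"
      by (auto simp: Phi_def universal_def bpair_def inj_prog_code compute_eq_Some_iff split: if_splits)
    have out: "out s i t = result ?o (prog_code g) i t" if "t \<ge> N" for i t
      using N[OF that] by (simp add: out_def orc_def s_def h_def[symmetric] a_def[symmetric] g)
    define L where "L i = (LEAST k. \<not> out s i (i + k) = 0)" for i
    \<comment> \<open>The search ends for early bits as well: if no run on a wrong guess halts
      first, a late stage with the final guess does.\<close>
    have ex: "\<exists>k. \<not> out s i (i + k) = 0" for i
    proof -
      obtain t where "result ?o (prog_code g) i t = Suc (r' i)"
        using result_complete[OF eval] by blast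
      then have "result ?o (prog_code g) i (i + (t + N)) = Suc (r' i)" by (rule result_mono) simp
      then have "\<not> out s i (i + (t + N)) = 0" using out[of "i + (t + N)" i] by simp
      then show ?thesis by blast
    qed
    define q where "q i \<longleftrightarrow> out s i (i + L i) = 2" for i
    have "eval s (Comp d (Tup e c)) i = Some (of_bool (q i))" for i
    proof -
      obtain k where "\<not> out s i (i + k) = 0" using ex by blast
      from c[OF this] show ?thesis by (simp add: d e q_def L_def)
    qed
    then have Ks: "K s = Some (\<lambda>i. of_bool (q i))"
      unfolding K_def compute_eq_Some_iff by blast
    have "q i = z i" if "i \<ge> N" for i
    proof -
      have "\<not> out s i (i + L i) = 0" unfolding L_def by (rule LeastI_ex[OF ex])
      then obtain y where y: "out s i (i + L i) = Suc y" using not0_implies_Suc by blast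
      then have "result ?o (prog_code g) i (i + L i) = Suc y" using out[of "i + L i" i] that by simp
      then have "y = r' i" using result_sound eval by fastforce
      moreover have "z i \<longleftrightarrow> r' i = 1" using z by (simp add: cantor_rep_eq_Some_iff)
      ultimately show ?thesis unfolding q_def y by simp
    qed
    then have "ml_random b q" by (rule ml_random_cong_finite[OF \<open>ml_random b z\<close>])
    moreover have "cantor_rep (\<lambda>i. of_bool (q i)) = Some q"
      by (simp add: cantor_rep_eq_Some_iff)
    ultimately show "\<exists>r y. Option.bind (Option.bind (Some (H p)) G) (\<lambda>r. K (bpair p r)) = Some r \<and>
        tgt MLR r = Some y \<and> y \<in> fn MLR b"
      using r(1) Ks by (simp add: s_def)
  qed
  with H K show ?thesis unfolding weihrauch_le_def by blast
qed

theorem proposition6p6: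
  shows "MLR \<equiv>\<^sub>W (C_nat \<rightarrow>\<^sub>W PC_cantor) \<and> (C_nat \<rightarrow>\<^sub>W PC_cantor) \<equiv>\<^sub>W (C_nat \<rightarrow>\<^sub>W WWKL)"
proof -
  have "MLR \<le>\<^sub>W (C_nat \<rightarrow>\<^sub>W PC_cantor)"
    by (rule weihrauch_le_trans[OF MLR_le_implication_WWKL implication_WWKL_le_PC])
  moreover have "(C_nat \<rightarrow>\<^sub>W PC_cantor) \<le>\<^sub>W (C_nat \<rightarrow>\<^sub>W WWKL)"
    by (rule weihrauch_le_trans[OF implication_PC_le_MLR MLR_le_implication_WWKL])
  ultimately show ?thesis
    unfolding weihrauch_equiv_def using implication_PC_le_MLR implication_WWKL_le_PC by blast
qed

end
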